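(* Let $c_1,\ldots,c_5\in\mathbb{H}$ be such that there is no $3$-dimensional real affine subspace of $\mathbb{H}\simeq\mathbb{R}^4$ containing all $c_i$. Then every slice regular function $f:\mathbb{H}\to\mathbb{H}$ with $f(\mathbb{H})\subset\mathbb{H}\setminus\{c_1,\ldots,c_5\}$ is constant.
   Context: $\mathbb{H}$ denotes the skew field of quaternions, regarded as a $4$-dimensional real vector space. A slice regular function $f:\mathbb{H}\to\mathbb{H}$ (entire slice regular function) is a function given by a globally convergent power series $f(q)=\sum_{k=0}^{\infty}q^k a_k$ with coefficients $a_k\in\mathbb{H}$ (on the right). *)

theory Defs
  imports "HOL-Analysis.Analysis"
begin

section \<open>Quaternions\<close>

text \<open>\<open>Quat a b c d\<close> stands for \<open>a + b i + c j + d k\<close>.\<close>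

codatatype quat = Quat (qRe: real) (qI: real) (qJ: real) (qK: real)

lemma quat_eq_iff:
  "p = q \<longleftrightarrow> qRe p = qRe q \<and> qI p = qI q \<and> qJ p = qJ q \<and> qK p = qK q"
  by (auto intro: quat.expand)

lemma quat_sum_squares_eq_0_iff:
  "(qRe q)\<^sup>2 + (qI q)\<^sup>2 + (qJ q)\<^sup>2 + (qK q)\<^sup>2 = 0
    \<longleftrightarrow> qRe q = 0 \<and> qI q = 0 \<and> qJ q = 0 \<and> qK q = 0"
  by (simp add: add_nonneg_eq_0_iff conj_assoc)

instantiation quat :: ab_group_add
begin

primcorec zero_quat where
  "qRe 0 = 0" | "qI 0 = 0" | "qJ 0 = 0" | "qK 0 = 0"

primcorec plus_quat where
  "qRe (p + q) = qRe p + qRe q"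
| "qI (p + q) = qI p + qI q"
| "qJ (p + q) = qJ p + qJ q"
| "qK (p + q) = qK p + qK q"

primcorec uminus_quat where
  "qRe (- q) = - qRe q"
| "qI (- q) = - qI q"
| "qJ (- q) = - qJ q"
| "qK (- q) = - qK q"

primcorec minus_quat where
  "qRe (p - q) = qRe p - qRe q"
| "qI (p - q) = qI p - qI q"
| "qJ (p - q) = qJ p - qJ q"
| "qK (p - q) = qK p - qK q"

instance
  by standard (simp_all add: quat_eq_iff)

end

instantiation quat :: ring_1
begin

primcorec one_quat where
  "qRe 1 = 1" | "qI 1 = 0" | "qJ 1 = 0" | "qK 1 = 0"

primcorec times_quat where
  "qRe (p * q) = qRe p * qRe q - qI p * qI q - qJ p * qJ q - qK p * qK q"
| "qI (p * q) = qRe p * qI q + qI p * qRe q + qJ p * qK q - qK p * qJ q"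
| "qJ (p * q) = qRe p * qJ q - qI p * qK q + qJ p * qRe q + qK p * qI q"
| "qK (p * q) = qRe p * qK q + qI p * qJ q - qJ p * qI q + qK p * qRe q"

instance
  by standard (simp_all add: quat_eq_iff algebra_simps)

end

instantiation quat :: real_algebra_1
begin

primcorec scaleR_quat where
  "qRe (r *\<^sub>R q) = r * qRe q"
| "qI (r *\<^sub>R q) = r * qI q"
| "qJ (r *\<^sub>R q) = r * qJ q"
| "qK (r *\<^sub>R q) = r * qK q"

instance
  by standard (simp_all add: quat_eq_iff algebra_simps)

end

instantiation quat :: real_div_algebra
begin

primcorec inverse_quat where
  "qRe (inverse q) = qRe q / ((qRe q)\<^sup>2 + (qI q)\<^sup>2 + (qJ q)\<^sup>2 + (qK q)\<^sup>2)"
| "qI (inverse q) = - qI q / ((qRe q)\<^sup>2 + (qI q)\<^sup>2 + (qJ q)\<^sup>2 + (qK q)\<^sup>2)"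
| "qJ (inverse q) = - qJ q / ((qRe q)\<^sup>2 + (qI q)\<^sup>2 + (qJ q)\<^sup>2 + (qK q)\<^sup>2)"
| "qK (inverse q) = - qK q / ((qRe q)\<^sup>2 + (qI q)\<^sup>2 + (qJ q)\<^sup>2 + (qK q)\<^sup>2)"

definition "p div q = p * inverse q" for p q :: quat

instance
proof
  fix p q :: quat
  show "p div q = p * inverse q"
    by (rule divide_quat_def)
  show "inverse (0::quat) = 0"
    by (simp add: quat_eq_iff)
  assume "p \<noteq> 0"
  define s where "s = (qRe p)\<^sup>2 + (qI p)\<^sup>2 + (qJ p)\<^sup>2 + (qK p)\<^sup>2"
  have s: "s \<noteq> 0"
    using \<open>p \<noteq> 0\<close> quat_sum_squares_eq_0_iff[of p] by (simp add: s_def quat_eq_iff)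
  have inv: "qRe (inverse p) = qRe p / s" "qI (inverse p) = - qI p / s"
    "qJ (inverse p) = - qJ p / s" "qK (inverse p) = - qK p / s"
    by (simp_all add: s_def)
  have *: "qRe p * qRe p / s + qI p * qI p / s + qJ p * qJ p / s + qK p * qK p / s = 1"
    unfolding add_divide_distrib[symmetric] using s by (simp add: s_def power2_eq_square)
  show "inverse p * p = 1" "p * inverse p = 1"
    using * by (simp_all add: quat_eq_iff inv mult.commute del: inverse_quat.simps)
qed

end

instantiation quat :: real_inner
begin

definition inner_quat :: "quat \<Rightarrow> quat \<Rightarrow> real" where
  "inner_quat p q = qRe p * qRe q + qI p * qI q + qJ p * qJ q + qK p * qK q"

definition norm_quat :: "quat \<Rightarrow> real" where
  "norm_quat q = sqrt ((qRe q)\<^sup>2 + (qI q)\<^sup>2 + (qJ q)\<^sup>2 + (qK q)\<^sup>2)"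

definition sgn_quat :: "quat \<Rightarrow> quat" where
  "sgn_quat q = q /\<^sub>R norm q"

definition dist_quat :: "quat \<Rightarrow> quat \<Rightarrow> real" where
  "dist_quat p q = norm (p - q)"

definition uniformity_quat :: "(quat \<times> quat) filter" where
  "uniformity_quat = (INF e\<in>{0<..}. principal {(x, y). dist x y < e})"

definition open_quat :: "quat set \<Rightarrow> bool" where
  "open_quat U \<longleftrightarrow> (\<forall>x\<in>U. eventually (\<lambda>(x', y). x' = x \<longrightarrow> y \<in> U) uniformity)"

instance
proof
  fix p q r :: quat and t :: real and U :: "quat set"
  show "dist p q = norm (p - q)"
    by (rule dist_quat_def)
  show "sgn q = q /\<^sub>R norm q"
    by (rule sgn_quat_def)
  show "(uniformity :: (quat \<times> quat) filter) = (INF e\<in>{0<..}. principal {(x, y). dist x y < e})"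
    by (rule uniformity_quat_def)
  show "open U \<longleftrightarrow> (\<forall>x\<in>U. eventually (\<lambda>(x', y). x' = x \<longrightarrow> y \<in> U) uniformity)"
    by (rule open_quat_def)
  show "p \<bullet> q = q \<bullet> p" "(p + q) \<bullet> r = p \<bullet> r + q \<bullet> r" "(t *\<^sub>R p) \<bullet> q = t * (p \<bullet> q)"
    by (simp_all add: inner_quat_def algebra_simps)
  show "0 \<le> p \<bullet> p"
    by (simp add: inner_quat_def)
  show "p \<bullet> p = 0 \<longleftrightarrow> p = 0"
    using quat_sum_squares_eq_0_iff[of p]
    by (simp add: inner_quat_def quat_eq_iff power2_eq_square)
  show "norm p = sqrt (p \<bullet> p)"
    by (simp add: norm_quat_def inner_quat_def power2_eq_square)
qed

end

instance quat :: real_normed_div_algebra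
proof
  fix p q :: quat
  show "norm (p * q) = norm p * norm q"
    unfolding norm_quat_def real_sqrt_mult[symmetric]
    by (simp add: power2_eq_square algebra_simps)
qed

instantiation quat :: euclidean_space
begin

definition Basis_quat :: "quat set" where
  "Basis_quat = {Quat 1 0 0 0, Quat 0 1 0 0, Quat 0 0 1 0, Quat 0 0 0 1}"

instance
proof
  fix u v p :: quat
  show "(Basis :: quat set) \<noteq> {}" "finite (Basis :: quat set)"
    by (simp_all add: Basis_quat_def)
  show "u \<bullet> v = (if u = v then 1 else 0)" if "u \<in> Basis" "v \<in> Basis"
    using that unfolding Basis_quat_def inner_quat_def
    by (elim insertE emptyE) simp_all
  show "(\<forall>u\<in>Basis. p \<bullet> u = 0) \<longleftrightarrow> p = 0"
    unfolding Basis_quat_def inner_quat_def by (simp add: quat_eq_iff[of p])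
qed

end

lemma DIM_quat [simp]: "DIM(quat) = 4"
  by (simp add: Basis_quat_def)

lemma quat_unit_products:
  "Quat 0 1 0 0 * Quat 0 1 0 0 = -1"
  "Quat 0 0 1 0 * Quat 0 0 1 0 = -1"
  "Quat 0 0 0 1 * Quat 0 0 0 1 = -1"
  "Quat 0 1 0 0 * Quat 0 0 1 0 = Quat 0 0 0 1"
  "Quat 0 0 1 0 * Quat 0 1 0 0 = - Quat 0 0 0 1"
  by (simp_all add: quat_eq_iff)


section \<open>Entire slice regular functions\<close>

definition entire_slice_regular :: "(quat \<Rightarrow> quat) \<Rightarrow> bool" where
  "entire_slice_regular f \<longleftrightarrow> (\<exists>a :: nat \<Rightarrow> quat. \<forall>q. (\<lambda>k. q ^ k * a k) sums f q)"

end

theory Submission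
  imports Defs "HOL-Complex_Analysis.Complex_Analysis" "HOL-Real_Asymp.Real_Asymp"
begin

text \<open>
The function \<open>f\<close> is determined by its stem function \<open>F\<close>, an entire map from the complex plane to the
complexified quaternions that is real on the real axis, and \<open>f\<close> omits \<open>c\<close> only if
\<open>u = \<Sum> (F\<^sub>e - c\<^sub>e)\<^sup>2\<close> has no zeros, so that \<open>u = exp g\<close>. Five points in general position yield five
such functions \<open>u\<^sub>i\<close>. Since \<open>u\<^sub>i - u\<^sub>j\<close> is affine in \<open>F\<close>, the map \<open>F\<close> is an affine combination of the
\<open>u\<^sub>i\<close>, and inserting this into the definition of one of the \<open>u\<^sub>i\<close> gives a quadratic relation between
them. By Borel's theorem on exponentials the relation splits according to the classes of the monomials
modulo units of slow growth. If some \<open>u\<^sub>i\<close> grows, the top class contributes a sum of squares of linear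
forms, which are real on the real axis and therefore vanish there; as only the multiples of
\<open>(1, 1, 1, 1, 1)\<close> annihilate the forms occurring, all \<open>u\<^sub>i\<close> agree on the real axis and \<open>F\<close> is constant.
If all \<open>u\<^sub>i\<close> are of slow growth, the \<open>g\<^sub>i\<close> are bounded by the logarithm of their own growth and
hence constant.
\<close>

section \<open>Bounds for quotients of entire functions\<close>

text \<open>The factorisation at a zero is local; the quotient of \<open>B\<close> by
  \<open>(z - a) ^ n\<close> away from \<open>a\<close> extends the local factor to the whole
  plane.\<close>

lemma entire_factor_zero:
  fixes B :: "complex \<Rightarrow> complex"
  assumes B: "B holomorphic_on UNIV" and "B a = 0" and "B b \<noteq> 0"
  obtains n G where "n > 0" "G holomorphic_on UNIV" "\<And>z. B z = (z - a) ^ n * G z" "G a \<noteq> 0"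
proof -
  have "\<not> B constant_on UNIV"
    using assms(2,3) by (metis UNIV_I constant_on_def)
  then obtain g r n where g: "0 < n" "0 < r" "g holomorphic_on ball a r"
    "\<And>w. w \<in> ball a r \<Longrightarrow> B w = (w - a) ^ n * g w" "\<And>w. w \<in> ball a r \<Longrightarrow> g w \<noteq> 0"
    using holomorphic_factor_zero_nonconstant[OF B open_UNIV connected_UNIV UNIV_I assms(2)] by metis
  define G where "G z = (if z = a then g a else B z / (z - a) ^ n)" for z
  have Gg: "G w = g w" if "w \<in> ball a r" for w
    using g(4)[OF that] by (auto simp: G_def)
  have "(\<lambda>z. B z / (z - a) ^ n) holomorphic_on - {a}"
    by (intro holomorphic_intros holomorphic_on_subset[OF B]) auto
  then have "G holomorphic_on - {a}"
    by (rule holomorphic_transform) (auto simp: G_def)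
  moreover have "G holomorphic_on ball a r"
    by (rule holomorphic_transform[OF g(3)]) (auto simp: Gg)
  ultimately have "G holomorphic_on (- {a} \<union> ball a r)"
    by (intro holomorphic_on_Un) auto
  moreover have "- {a} \<union> ball a r = UNIV"
    using g(2) by auto
  moreover have "B z = (z - a) ^ n * G z" for z
    using g(1) assms(2) by (auto simp: G_def)
  moreover have "G a \<noteq> 0"
    using g(2) g(5)[of a] by (auto simp: G_def)
  ultimately show ?thesis
    using that g(1) by auto
qed

text \<open>A Harnack-type inequality: the Cayley transform
  \<open>(p - p 0) / (p + cnj (p 0))\<close> maps the right half-plane to the unit disc and
  \<open>p 0\<close> to 0, so Schwarz's lemma applies after rescaling the disc.\<close>

lemma norm_le_of_Re_pos:
  fixes p :: "complex \<Rightarrow> complex"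
  assumes p: "p holomorphic_on ball 0 R" and pos: "\<And>z. norm z < R \<Longrightarrow> Re (p z) > 0"
    and z: "norm z < R"
  shows "norm (p z) \<le> norm (p 0) * ((R + norm z) / (R - norm z))"
proof -
  have R: "R > 0"
    using z norm_ge_zero[of z] by linarith
  define f where "f w = (p (of_real R * w) - p 0) / (p (of_real R * w) + cnj (p 0))" for w
  have in_ball: "norm (of_real R * w) < R" if "norm w < 1" for w :: complex
    using that R by (simp add: norm_mult)
  have nz: "p w + cnj (p 0) \<noteq> 0" if "norm w < R" for w
  proof
    assume "p w + cnj (p 0) = 0"
    then have "Re (p w + cnj (p 0)) = 0"
      by (simp only: zero_complex.sel)
    then have "Re (p w) + Re (p 0) = 0"
      by simp
    then show False
      using pos[OF that] pos[of 0] R by simp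
  qed
  have "(\<lambda>w. p (of_real R * w)) holomorphic_on ball 0 1"
    by (rule holomorphic_on_compose_gen[OF _ p, of "\<lambda>w. of_real R * w" "ball 0 1", unfolded o_def])
      (use in_ball in \<open>auto intro!: holomorphic_intros\<close>)
  then have hol: "f holomorphic_on ball 0 1"
    unfolding f_def using nz in_ball by (intro holomorphic_intros) auto
  have lt: "norm (f w) < 1" if "norm w < 1" for w
  proof -
    let ?q = "p (of_real R * w)"
    \<comment> \<open>\<open>- cnj (p 0)\<close> is the mirror image of \<open>p 0\<close> in the
      imaginary axis, so points of the right half-plane lie closer to \<open>p 0\<close>.\<close>
    have "(norm (?q + cnj (p 0)))\<^sup>2 - (norm (?q - p 0))\<^sup>2 = 4 * (Re ?q * Re (p 0))"
      unfolding cmod_power2 by (simp add: power2_eq_square algebra_simps)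
    also have "\<dots> > 0"
      using pos[OF in_ball[OF that]] pos[of 0] R by simp
    finally have "norm (?q - p 0) < norm (?q + cnj (p 0))"
      by (simp add: power2_less_imp_less)
    then show ?thesis
      using nz[OF in_ball[OF that]] by (simp add: f_def norm_divide divide_simps)
  qed
  define w where "w = z / of_real R"
  have w: "norm w < 1" "norm w = norm z / R" "of_real R * w = z"
    using z R by (auto simp: w_def norm_divide)
  have "norm (f w) \<le> norm w"
    by (rule Schwarz_Lemma(1)[OF hol]) (use lt w in \<open>auto simp: f_def\<close>)
  moreover have "norm (f w) = norm (p z - p 0) / norm (p z + cnj (p 0))"
    by (simp add: f_def w(3) norm_divide)
  ultimately have *: "norm (p z - p 0) \<le> norm w * norm (p z + cnj (p 0))"
    using nz[OF z] by (simp add: pos_divide_le_eq)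
  have "norm (p z) \<le> norm (p 0) + norm (p z - p 0)"
    by norm
  also have "\<dots> \<le> norm (p 0) + norm w * (norm (p z) + norm (p 0))"
    using order_trans[OF * mult_left_mono[OF norm_triangle_ineq norm_ge_zero]] by simp
  finally have "R * norm (p z) \<le> R * (norm (p 0) + norm z / R * (norm (p z) + norm (p 0)))"
    using R by (intro mult_left_mono) (auto simp: w(2))
  then have "norm (p z) * (R - norm z) \<le> norm (p 0) * (R + norm z)"
    using R by (simp add: algebra_simps)
  then show ?thesis
    using z by (simp add: pos_le_divide_eq)
qed

text \<open>Dividing by Blaschke factors removes the zeros inside the disc without changing the modulus
  on its boundary, and it can only increase the modulus at the centre.\<close>

lemma entire_divide_zeros_in_ball:
  fixes B :: "complex \<Rightarrow> complex"
  assumes "R > 0" "B holomorphic_on UNIV" "B 0 \<noteq> 0"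
  shows "\<exists>G. G holomorphic_on UNIV \<and> (\<forall>z. norm z < R \<longrightarrow> G z \<noteq> 0) \<and>
    (\<forall>z. norm z = R \<longrightarrow> norm (G z) = norm (B z)) \<and> norm (B 0) \<le> norm (G 0)"
  using assms(2,3)
proof (induction "card {z \<in> ball 0 R. B z = 0}" arbitrary: B rule: less_induct)
  case less
  note B = less.prems
  show ?case
  proof (cases "{z \<in> ball 0 R. B z = 0} = {}")
    case True
    then show ?thesis
      using B by (intro exI[of _ B]) auto
  next
    case False
    then obtain a where a: "norm a < R" "B a = 0"
      by auto
    have a0: "a \<noteq> 0"
      using a B by auto
    obtain n G where G: "n > 0" "G holomorphic_on UNIV" "\<And>z. B z = (z - a) ^ n * G z" "G a \<noteq> 0"
      using entire_factor_zero[OF B(1) a(2) B(2)] by blast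
    \<comment> \<open>On the circle of radius \<open>R\<close> the new factor has the modulus of
      \<open>z - a\<close>, and it has no zeros inside; so \<open>H\<close> keeps the boundary
      modulus of \<open>B\<close> and loses the zero \<open>a\<close>.\<close>
    define H where "H z = ((of_real (R\<^sup>2) - cnj a * z) / R) ^ n * G z" for z
    have nz: "of_real (R\<^sup>2) - cnj a * z \<noteq> 0" if "norm z < R" for z
    proof
      assume "of_real (R\<^sup>2) - cnj a * z = 0"
      then have "norm (of_real (R\<^sup>2) :: complex) = norm (cnj a * z)"
        by simp
      then have "R * R = norm a * norm z"
        by (simp add: norm_mult power2_eq_square)
      moreover have "norm a * norm z < R * R"
        using that a by (intro mult_strict_mono') auto
      ultimately show False
        by simp
    qed
    have H: "H holomorphic_on UNIV"
      unfolding H_def by (intro holomorphic_intros G(2)) (use \<open>R > 0\<close> in auto)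
    have H0: "norm (B 0) \<le> norm (H 0)"
    proof -
      have "norm (B 0) = norm a ^ n * norm (G 0)"
        by (simp add: G(3)[of 0] norm_mult norm_power)
      also have "\<dots> \<le> R ^ n * norm (G 0)"
        using a by (intro mult_right_mono power_mono) auto
      also have "\<dots> = norm (H 0)"
        using \<open>R > 0\<close> by (simp add: H_def norm_mult norm_power power2_eq_square)
      finally show ?thesis .
    qed
    have "B b = 0" "b \<noteq> a" if "norm b < R" "H b = 0" for b
    proof -
      have "G b = 0"
        using that nz[of b] \<open>R > 0\<close> by (simp add: H_def)
      then show "B b = 0" "b \<noteq> a"
        using G(3,4) by auto
    qed
    then have "{z \<in> ball 0 R. H z = 0} \<subset> {z \<in> ball 0 R. B z = 0}"
      using a by fastforce
    moreover have "finite {z \<in> ball 0 R. B z = 0}"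
    proof (rule finite_subset)
      show "finite {z \<in> cball 0 R. B z = 0}"
      proof (rule holomorphic_compact_finite_zeros[OF B(1)])
        show "\<not> B constant_on UNIV"
          using a(2) B(2) by (metis UNIV_I constant_on_def)
      qed auto
    qed auto
    ultimately have "card {z \<in> ball 0 R. H z = 0} < card {z \<in> ball 0 R. B z = 0}"
      by (rule psubset_card_mono[rotated])
    moreover have "H 0 \<noteq> 0"
      using H0 B(2) by auto
    ultimately obtain E where E: "E holomorphic_on UNIV" "\<And>z. norm z < R \<Longrightarrow> E z \<noteq> 0"
      "\<And>z. norm z = R \<Longrightarrow> norm (E z) = norm (H z)" "norm (H 0) \<le> norm (E 0)"
      using less.hyps[OF _ H] by blast
    have "norm (H z) = norm (B z)" if "norm z = R" for z
    proof -
      have "of_real (R\<^sup>2) - cnj a * z = z * cnj (z - a)"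
        using that by (simp add: algebra_simps complex_norm_square[symmetric])
      then have "norm (of_real (R\<^sup>2) - cnj a * z) = R * norm (z - a)"
        using that by (metis complex_mod_cnj norm_mult)
      then show ?thesis
        using \<open>R > 0\<close> by (simp add: H_def G(3)[of z] norm_mult norm_power norm_divide)
    qed
    then show ?thesis
      using E H0 by (intro exI[of _ E]) auto
  qed
qed

text \<open>Once the zeros of \<open>B\<close> have been removed, Harnack's inequality bounds \<open>\<bar>B\<bar>\<close> from below.\<close>

lemma Re_quotient_le:
  fixes B h :: "complex \<Rightarrow> complex"
  assumes B: "B holomorphic_on UNIV" and h: "h holomorphic_on UNIV" and B0: "B 0 \<noteq> 0"
    and M: "\<And>z. norm z = R \<Longrightarrow> norm (B z) \<le> exp M" "\<And>z. norm z = R \<Longrightarrow> norm (B z * exp (h z)) \<le> exp M"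
    and z: "norm z < R"
  shows "Re (h z) \<le> (M + 1 - ln (norm (B 0))) * ((R + norm z) / (R - norm z))"
proof -
  have R: "R > 0"
    using z norm_ge_zero[of z] by linarith
  obtain G where G: "G holomorphic_on UNIV" "\<And>z. norm z < R \<Longrightarrow> G z \<noteq> 0"
    "\<And>z. norm z = R \<Longrightarrow> norm (G z) = norm (B z)" "norm (B 0) \<le> norm (G 0)"
    using entire_divide_zeros_in_ball[OF R B B0] by blast
  have max: "norm (f w) \<le> exp M"
    if "norm w < R" "f holomorphic_on UNIV" "\<And>z. norm z = R \<Longrightarrow> norm (f z) \<le> exp M" for w and f :: "complex \<Rightarrow> complex"
  proof (rule maximum_modulus_frontier[where S = "cball 0 R" and f = f and \<xi> = w])
    show "f holomorphic_on interior (cball 0 R)" "continuous_on (closure (cball 0 R)) f"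
      using that(2) by (auto intro: holomorphic_on_subset holomorphic_on_imp_continuous_on continuous_on_subset)
  qed (use that R in \<open>auto simp: frontier_cball\<close>)
  obtain l where l: "l holomorphic_on ball 0 R" "\<And>z. z \<in> ball 0 R \<Longrightarrow> exp (l z) = G z"
  proof (rule holomorphic_logarithm_exists[of "ball 0 R" G 0])
    show "G holomorphic_on ball 0 R"
      using G(1) by (rule holomorphic_on_subset) simp
  qed (use G(2) R in auto)
  have Re_l: "Re (l w) \<le> M" if "norm w < R" for w
  proof -
    have "exp (Re (l w)) = norm (G w)"
      using l(2)[of w] that by (simp flip: norm_exp_eq_Re)
    also have "\<dots> \<le> exp M"
      using M(1) G(3) by (intro max[OF that G(1)]) simp
    finally show ?thesis
      by simp
  qed
  have sum: "Re (l z) + Re (h z) \<le> M"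
  proof -
    have "norm (G z * exp (h z)) \<le> exp M"
    proof (rule max[OF z])
      show "(\<lambda>z. G z * exp (h z)) holomorphic_on UNIV"
        by (intro holomorphic_intros G(1) h)
    qed (use M(2) G(3) in \<open>simp add: norm_mult\<close>)
    also have "norm (G z * exp (h z)) = exp (Re (l z) + Re (h z))"
      using l(2)[of z] z by (simp add: norm_mult exp_add flip: norm_exp_eq_Re)
    finally show ?thesis
      by simp
  qed
  \<comment> \<open>The summand \<open>M + 1\<close> makes the real part at least 1 on the disc; the
    imaginary constant makes \<open>p 0\<close> real, so that its norm is exactly
    \<open>M + 1 - Re (l 0)\<close>.\<close>
  define p where "p w = of_real (M + 1) + \<i> * of_real (Im (l 0)) - l w" for w
  have "norm (p z) \<le> norm (p 0) * ((R + norm z) / (R - norm z))"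
  proof (rule norm_le_of_Re_pos[OF _ _ z])
    show "p holomorphic_on ball 0 R"
      unfolding p_def by (intro holomorphic_intros l(1))
    show "Re (p w) > 0" if "norm w < R" for w
      using Re_l[OF that] by (simp add: p_def)
  qed
  moreover have p0: "norm (p 0) = M + 1 - Re (l 0)"
    using Re_l[of 0] R by (simp add: p_def cmod_def)
  moreover have lnB: "ln (norm (B 0)) \<le> Re (l 0)"
  proof -
    have "exp (Re (l 0)) = norm (G 0)"
      using l(2)[of 0] R by (simp flip: norm_exp_eq_Re)
    then have "norm (B 0) \<le> exp (Re (l 0))"
      using G(4) by simp
    then show ?thesis
      using B0 by (metis ln_exp ln_mono zero_less_norm_iff)
  qed
  moreover have "Re (h z) \<le> Re (p z)"
    using sum by (simp add: p_def)
  moreover have "Re (p z) \<le> norm (p z)"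
    by (rule complex_Re_le_cmod)
  moreover have "(R + norm z) / (R - norm z) \<ge> 0"
    using z R by simp
  then have "norm (p 0) * ((R + norm z) / (R - norm z)) \<le> (M + 1 - ln (norm (B 0))) * ((R + norm z) / (R - norm z))"
    using lnB by (intro mult_right_mono) (auto simp: p0)
  ultimately show ?thesis
    by linarith
qed

section \<open>Borel's theorem on exponentials\<close>

locale growth_scale =
  fixes L :: "real \<Rightarrow> real"
  assumes L_ge_1: "1 \<le> R \<Longrightarrow> 1 \<le> L R"
begin

text \<open>The powers of \<open>R / (R - r)\<close> absorb the losses in Cauchy's and Harnack's inequalities, so that no
  exceptional radii have to be excluded. Below, \<open>L R\<close> is the logarithm of the maximum on \<open>\<bar>z\<bar> \<le> R\<close> of the
  exponents under consideration: a tame function is at most a power of them.\<close>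

definition tame :: "(complex \<Rightarrow> complex) \<Rightarrow> bool" where
  "tame a \<longleftrightarrow> a holomorphic_on UNIV \<and>
    (\<exists>K::nat. \<forall>r R z. 1 \<le> r \<longrightarrow> r < R \<longrightarrow> norm z \<le> r \<longrightarrow> norm (a z) \<le> exp (K * (R / (R - r)) ^ K * L R))"

text \<open>Since \<open>R / (R - r)\<close> and \<open>L R\<close> are at least 1, a real constant
  and a separate exponent can both be raised to one common natural number.\<close>

lemma tameI:
  assumes "a holomorphic_on UNIV"
    and le: "\<And>r R z. 1 \<le> r \<Longrightarrow> r < R \<Longrightarrow> norm z \<le> r \<Longrightarrow> norm (a z) \<le> exp (C * (R / (R - r)) ^ k * L R)"
  shows "tame a"
proof -
  define K where "K = max k (nat \<lceil>C\<rceil>)"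
  have "C \<le> real (nat \<lceil>C\<rceil>)"
    by linarith
  then have C: "C \<le> K"
    by (simp add: K_def)
  have "norm (a z) \<le> exp (K * (R / (R - r)) ^ K * L R)" if "1 \<le> r" "r < R" "norm z \<le> r" for r R z
  proof -
    have "R / (R - r) \<ge> 1"
      using that by (simp add: divide_simps)
    then have "C * (R / (R - r)) ^ k * L R \<le> K * (R / (R - r)) ^ K * L R"
      using C L_ge_1[of R] that by (intro mult_mono power_increasing order_refl) (auto simp: K_def)
    then show ?thesis
      using le[OF that] by (meson exp_le_cancel_iff order_trans)
  qed
  then show ?thesis
    using assms(1) by (auto simp: tame_def)
qed

text \<open>Leaving the exponent free above a threshold brings the estimates for two functions to a
  common exponent.\<close>

lemma tameE:
  assumes "tame a"
  obtains K where "K \<ge> 0"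
    "\<And>k r R z. k \<ge> nat \<lceil>K\<rceil> \<Longrightarrow> 1 \<le> r \<Longrightarrow> r < R \<Longrightarrow> norm z \<le> r \<Longrightarrow> norm (a z) \<le> exp (K * (R / (R - r)) ^ k * L R)"
proof -
  obtain K :: nat where K: "norm (a z) \<le> exp (K * (R / (R - r)) ^ K * L R)"
    if "1 \<le> r" "r < R" "norm z \<le> r" for r R z
    using assms by (auto simp: tame_def)
  have "norm (a z) \<le> exp (K * (R / (R - r)) ^ k * L R)" if "k \<ge> K" "1 \<le> r" "r < R" "norm z \<le> r" for k r R z
  proof -
    have "R / (R - r) \<ge> 1"
      using that by (simp add: divide_simps)
    then have "K * (R / (R - r)) ^ K * L R \<le> K * (R / (R - r)) ^ k * L R"
      using L_ge_1[of R] that by (intro mult_mono power_increasing order_refl) auto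
    then show ?thesis
      using K[OF that(2-4)] by (meson exp_le_cancel_iff order_trans)
  qed
  then show ?thesis
    using that[of "real K"] by auto
qed

section \<open>Closure properties of tame functions\<close>

lemma tame_holomorphic: "tame a \<Longrightarrow> a holomorphic_on UNIV"
  by (simp add: tame_def)

lemma tame_mult:
  assumes "tame a" "tame b"
  shows "tame (\<lambda>z. a z * b z)"
proof -
  obtain A where A: "A \<ge> 0"
    "\<And>k r R z. k \<ge> nat \<lceil>A\<rceil> \<Longrightarrow> 1 \<le> r \<Longrightarrow> r < R \<Longrightarrow> norm z \<le> r \<Longrightarrow> norm (a z) \<le> exp (A * (R / (R - r)) ^ k * L R)"
    using tameE[OF assms(1)] by blast
  obtain B where B: "B \<ge> 0"
    "\<And>k r R z. k \<ge> nat \<lceil>B\<rceil> \<Longrightarrow> 1 \<le> r \<Longrightarrow> r < R \<Longrightarrow> norm z \<le> r \<Longrightarrow> norm (b z) \<le> exp (B * (R / (R - r)) ^ k * L R)"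
    using tameE[OF assms(2)] by blast
  show ?thesis
  proof (rule tameI[of _ "A + B" "max (nat \<lceil>A\<rceil>) (nat \<lceil>B\<rceil>)"])
    show "norm (a z * b z) \<le> exp ((A + B) * (R / (R - r)) ^ max (nat \<lceil>A\<rceil>) (nat \<lceil>B\<rceil>) * L R)"
      if "1 \<le> r" "r < R" "norm z \<le> r" for r R z
      unfolding norm_mult distrib_right exp_add
      using that by (intro mult_mono A B) auto
  qed (intro holomorphic_intros assms[THEN tame_holomorphic])
qed

lemma tame_const: "tame (\<lambda>_. c)"
proof (rule tameI[of _ "norm c" 0])
  show "norm c \<le> exp (norm c * (R / (R - r)) ^ 0 * L R)" if "1 \<le> r" "r < R" for r R
  proof -
    have "norm c \<le> exp (norm c * 1)"
      using exp_ge_add_one_self[of "norm c"] unfolding mult_1_right by linarith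
    also have "\<dots> \<le> exp (norm c * L R)"
      using L_ge_1[of R] that by (simp add: mult_le_cancel_left1)
    finally show ?thesis
      by simp
  qed
qed auto

lemma tame_add:
  assumes "tame a" "tame b"
  shows "tame (\<lambda>z. a z + b z)"
proof -
  obtain A where A: "A \<ge> 0"
    "\<And>k r R z. k \<ge> nat \<lceil>A\<rceil> \<Longrightarrow> 1 \<le> r \<Longrightarrow> r < R \<Longrightarrow> norm z \<le> r \<Longrightarrow> norm (a z) \<le> exp (A * (R / (R - r)) ^ k * L R)"
    using tameE[OF assms(1)] by blast
  obtain B where B: "B \<ge> 0"
    "\<And>k r R z. k \<ge> nat \<lceil>B\<rceil> \<Longrightarrow> 1 \<le> r \<Longrightarrow> r < R \<Longrightarrow> norm z \<le> r \<Longrightarrow> norm (b z) \<le> exp (B * (R / (R - r)) ^ k * L R)"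
    using tameE[OF assms(2)] by blast
  define k where "k = max (nat \<lceil>A\<rceil>) (nat \<lceil>B\<rceil>)"
  show ?thesis
  proof (rule tameI[of _ "A + B + 1" k])
    fix r R z assume *: "1 \<le> r" "r < R" "norm (z::complex) \<le> r"
    define X where "X = (R / (R - r)) ^ k * L R"
    have "1 * 1 \<le> X"
      unfolding X_def using * L_ge_1[of R] by (intro mult_mono one_le_power) (auto simp: divide_simps)
    then have X: "X \<ge> 1"
      by simp
    have "norm (a z) \<le> exp (A * X)" "norm (b z) \<le> exp (B * X)"
      using A(2)[of k r R z] B(2)[of k r R z] * by (auto simp: k_def X_def mult.assoc)
    moreover have "A * X \<le> (A + B) * X" "B * X \<le> (A + B) * X"
      using A(1) B(1) X by (auto intro!: mult_right_mono)
    ultimately have "norm (a z) \<le> exp ((A + B) * X)" "norm (b z) \<le> exp ((A + B) * X)"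
      by (meson exp_le_cancel_iff order_trans)+
    then have "norm (a z + b z) \<le> exp ((A + B) * X) * 2"
      by norm
    also have "2 \<le> exp X"
      using X exp_ge_add_one_self[of X] by linarith
    also have "exp ((A + B) * X) * exp X = exp ((A + B + 1) * (R / (R - r)) ^ k * L R)"
      by (simp add: X_def algebra_simps flip: exp_add)
    finally show "norm (a z + b z) \<le> exp ((A + B + 1) * (R / (R - r)) ^ k * L R)"
      by simp
  qed (intro holomorphic_intros assms[THEN tame_holomorphic])
qed

lemma tame_minus: "tame a \<Longrightarrow> tame (\<lambda>z. - a z)"
  using tame_mult[OF tame_const[of "- 1"]] by simp

lemma tame_diff: "tame a \<Longrightarrow> tame b \<Longrightarrow> tame (\<lambda>z. a z - b z)"
  using tame_add[OF _ tame_minus] by simp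

lemma tame_sum: "(\<And>i. i \<in> I \<Longrightarrow> tame (a i)) \<Longrightarrow> tame (\<lambda>z. \<Sum>i\<in>I. a i z)"
  by (induction I rule: infinite_finite_induct) (auto intro: tame_const tame_add)

text \<open>Cauchy's estimate on circles of radius \<open>(R - r) / 2\<close> stays below the
  midpoint of \<open>r\<close> and \<open>R\<close>. This doubles the ratio
  \<open>R / (R - r)\<close>, and the factor \<open>1 / d\<close> is absorbed by one more
  exponential.\<close>

lemma tame_deriv:
  assumes "tame a"
  shows "tame (deriv a)"
proof -
  obtain A where A: "A \<ge> 0"
    "\<And>k r R z. k \<ge> nat \<lceil>A\<rceil> \<Longrightarrow> 1 \<le> r \<Longrightarrow> r < R \<Longrightarrow> norm z \<le> r \<Longrightarrow> norm (a z) \<le> exp (A * (R / (R - r)) ^ k * L R)"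
    using tameE[OF assms] by blast
  define k where "k = Suc (nat \<lceil>A\<rceil>)"
  then have k: "nat \<lceil>A\<rceil> \<le> k"
    using le_SucI by blast
  show ?thesis
  proof (rule tameI[of _ "(A + 1) * 2 ^ k" k])
    show "deriv a holomorphic_on UNIV"
      using tame_holomorphic[OF assms] by (rule holomorphic_deriv) auto
  next
    fix r R z assume *: "1 \<le> r" "r < R" "norm (z::complex) \<le> r"
    define d where "d = (R - r) / 2"
    have d: "d > 0" "r + d < R" "1 \<le> r + d"
      using * by (auto simp: d_def field_simps)
    have Rd: "R / (R - (r + d)) = 2 * R / (R - r)"
      using * by (simp add: d_def field_simps)
    define X where "X = (2 * R / (R - r)) ^ k * L R"
    have "norm ((deriv ^^ 1) a z) \<le> fact 1 * exp (A * X) / d ^ 1"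
    proof (rule Cauchy_inequality)
      show "norm (a w) \<le> exp (A * X)" if "norm (z - w) = d" for w
      proof -
        have "norm w \<le> r + d"
          using that *(3) norm_triangle_ineq4[of z "z - w"] by simp
        then show ?thesis
          using A(2)[OF k d(3,2), of w] by (simp only: Rd X_def mult.assoc)
      qed
    qed (use d tame_holomorphic[OF assms] in \<open>auto intro: holomorphic_on_subset holomorphic_on_imp_continuous_on continuous_on_subset\<close>)
    then have "norm (deriv a z) \<le> exp (A * X) * (1 / d)"
      by simp
    also have "1 / d \<le> exp X"
    proof -
      have "1 / d \<le> 2 * R / (R - r)"
        using * by (simp add: d_def divide_right_mono)
      also have "\<dots> = (2 * R / (R - r)) ^ 1 * 1"
        by simp
      also have "\<dots> \<le> X"
        unfolding X_def using * L_ge_1[of R]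
        by (intro mult_mono power_increasing) (auto simp: k_def divide_simps)
      also have "\<dots> \<le> exp X"
        using exp_ge_add_one_self[of X] by linarith
      finally show ?thesis .
    qed
    also have "exp (A * X) * exp X = exp ((A + 1) * 2 ^ k * (R / (R - r)) ^ k * L R)"
    proof -
      have "(2 * R / (R - r)) ^ k = 2 ^ k * (R / (R - r)) ^ k"
        by (simp flip: power_mult_distrib)
      then show ?thesis
        by (simp add: X_def algebra_simps flip: exp_add)
    qed
    finally show "norm (deriv a z) \<le> exp ((A + 1) * 2 ^ k * (R / (R - r)) ^ k * L R)"
      by (simp add: mult_left_mono)
  qed
qed

lemma tame_of_norm_le:
  assumes "g holomorphic_on UNIV" "\<And>R z. norm z \<le> R \<Longrightarrow> norm (g z) \<le> exp (L R)"
  shows "tame g"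
  by (rule tameI[of _ 1 0]) (use assms in auto)

text \<open>This is where the restriction to radii \<open>r \<ge> 1\<close> in the definition of \<open>tame\<close> is needed.\<close>

lemma tame_divide_power:
  assumes "tame a" and G: "G holomorphic_on UNIV" and eq: "\<And>z. a z = z ^ n * G z"
  shows "tame G"
proof -
  obtain A where A: "A \<ge> 0"
    "\<And>k r R z. k \<ge> nat \<lceil>A\<rceil> \<Longrightarrow> 1 \<le> r \<Longrightarrow> r < R \<Longrightarrow> norm z \<le> r \<Longrightarrow> norm (a z) \<le> exp (A * (R / (R - r)) ^ k * L R)"
    using tameE[OF assms(1)] by blast
  show ?thesis
  proof (rule tameI[OF G])
    fix r R z assume *: "1 \<le> r" "r < R" "norm (z::complex) \<le> r"
    show "norm (G z) \<le> exp (A * (R / (R - r)) ^ nat \<lceil>A\<rceil> * L R)"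
    proof (rule maximum_modulus_frontier[where S = "cball 0 r" and f = G and \<xi> = z])
      show "norm (G w) \<le> exp (A * (R / (R - r)) ^ nat \<lceil>A\<rceil> * L R)" if "w \<in> frontier (cball 0 r)" for w
      proof -
        have w: "norm w = r"
          using that * by (simp add: frontier_cball)
        have "1 * norm (G w) \<le> norm w ^ n * norm (G w)"
          using w * by (intro mult_right_mono one_le_power) auto
        also have "\<dots> = norm (a w)"
          by (simp add: eq norm_mult norm_power)
        also have "\<dots> \<le> exp (A * (R / (R - r)) ^ nat \<lceil>A\<rceil> * L R)"
          using * w by (intro A) auto
        finally show ?thesis
          by simp
      qed
    qed (use * G in \<open>auto intro: holomorphic_on_subset holomorphic_on_imp_continuous_on continuous_on_subset\<close>)
  qed
qed

text \<open>\<open>Re_quotient_le\<close>, applied at the midpoint of \<open>r\<close> and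
  \<open>R\<close>, bounds \<open>Re (h z)\<close> at the cost of one more power of
  \<open>R / (R - r)\<close>. It requires \<open>B 0\<close> to be nonzero, so a zero of
  \<open>B\<close> at the origin is first divided out of \<open>A\<close> and
  \<open>B\<close>.\<close>

lemma tame_exp_of_quotient:
  assumes A: "tame A" and B: "tame B" and h: "h holomorphic_on UNIV"
    and eq: "\<And>z. B z * exp (h z) = A z" and nz: "B w \<noteq> 0"
  shows "tame (\<lambda>z. exp (h z))"
proof -
  have main: "tame (\<lambda>z. exp (h z))"
    if A: "tame A" and B: "tame B" and eq: "\<And>z. B z * exp (h z) = A z" and nz: "B 0 \<noteq> 0" for A B
  proof -
    obtain a where a: "a \<ge> 0"
      "\<And>k r R z. k \<ge> nat \<lceil>a\<rceil> \<Longrightarrow> 1 \<le> r \<Longrightarrow> r < R \<Longrightarrow> norm z \<le> r \<Longrightarrow> norm (A z) \<le> exp (a * (R / (R - r)) ^ k * L R)"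
      using tameE[OF A] by blast
    obtain b where b: "b \<ge> 0"
      "\<And>k r R z. k \<ge> nat \<lceil>b\<rceil> \<Longrightarrow> 1 \<le> r \<Longrightarrow> r < R \<Longrightarrow> norm z \<le> r \<Longrightarrow> norm (B z) \<le> exp (b * (R / (R - r)) ^ k * L R)"
      using tameE[OF B] by blast
    define k where "k = max (nat \<lceil>a\<rceil>) (nat \<lceil>b\<rceil>)"
    define c where "c = a + b + 1 + \<bar>ln (norm (B 0))\<bar>"
    have c: "c \<ge> 1"
      using a b by (simp add: c_def)
    show ?thesis
    proof (rule tameI[of _ "c * 2 ^ k * 4" "Suc k"])
      fix r R z assume *: "1 \<le> r" "r < R" "norm (z::complex) \<le> r"
      define d where "d = (R - r) / 2"
      have d: "d > 0" "r + d < R" "1 \<le> r + d"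
        using * by (auto simp: d_def field_simps)
      have Rd: "R / (R - (r + d)) = 2 * (R / (R - r))"
        using * by (simp add: d_def field_simps)
      define X where "X = (2 * (R / (R - r))) ^ k * L R"
      have "1 * 1 \<le> X"
        unfolding X_def using * L_ge_1[of R] by (intro mult_mono one_le_power) (auto simp: divide_simps)
      then have X: "X \<ge> 1"
        by simp
      have *: "norm (B w) \<le> exp ((a + b) * X)" "norm (B w * exp (h w)) \<le> exp ((a + b) * X)"
        if "norm w = r + d" for w
      proof -
        have "norm (A w) \<le> exp (a * X)" "norm (B w) \<le> exp (b * X)"
          using a(2)[of k "r + d" R w] b(2)[of k "r + d" R w] d that by (simp_all add: k_def X_def Rd mult.assoc)
        moreover have "a * X \<le> (a + b) * X" "b * X \<le> (a + b) * X"
          using a(1) b(1) X by (auto intro!: mult_right_mono)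
        ultimately show "norm (B w) \<le> exp ((a + b) * X)" "norm (B w * exp (h w)) \<le> exp ((a + b) * X)"
          unfolding eq by (meson exp_le_cancel_iff order_trans)+
      qed
      have z: "norm z < r + d"
        using d \<open>norm z \<le> r\<close> by linarith
      have "Re (h z) \<le> ((a + b) * X + 1 - ln (norm (B 0))) * ((r + d + norm z) / (r + d - norm z))"
        by (rule Re_quotient_le[OF tame_holomorphic[OF B] h nz _ _ z]) (use * in auto)
      also have "\<dots> \<le> (c * X) * (4 * (R / (R - r)))"
      proof (rule mult_mono)
        have "1 + \<bar>ln (norm (B 0))\<bar> \<le> (1 + \<bar>ln (norm (B 0))\<bar>) * X"
          using X by (simp add: mult_le_cancel_left1)
        then show "(a + b) * X + 1 - ln (norm (B 0)) \<le> c * X"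
          by (simp add: c_def algebra_simps)
        have "(r + d + norm z) / (r + d - norm z) \<le> (2 * R) / d"
          using \<open>norm z \<le> r\<close> d by (intro frac_le) auto
        also have "\<dots> = 4 * (R / (R - r))"
          by (simp add: d_def)
        finally show "(r + d + norm z) / (r + d - norm z) \<le> 4 * (R / (R - r))" .
      qed (use c X z d in auto)
      also have "\<dots> = c * 2 ^ k * 4 * (R / (R - r)) ^ Suc k * L R"
        by (simp only: X_def power_mult_distrib power_Suc mult_ac)
      finally show "norm (exp (h z)) \<le> exp (c * 2 ^ k * 4 * (R / (R - r)) ^ Suc k * L R)"
        by simp
    qed (intro holomorphic_intros h)
  qed
  show ?thesis
  proof (cases "B 0 = 0")
    case True
    obtain n G where G: "n > 0" "G holomorphic_on UNIV" "\<And>z. B z = (z - 0) ^ n * G z" "G 0 \<noteq> 0"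
      using entire_factor_zero[OF tame_holomorphic[OF B] True nz] by blast
    have "tame G"
      by (rule tame_divide_power[OF B G(2), where n = n]) (use G(3) in simp)
    moreover have "tame (\<lambda>z. G z * exp (h z))"
    proof (rule tame_divide_power[OF A, where n = n])
      show "A z = z ^ n * (G z * exp (h z))" for z
        using G(3)[of z] by (simp flip: eq)
    qed (intro holomorphic_intros G(2) h)
    ultimately show ?thesis
      using main G(4) by blast
  qed (rule main[OF A B eq])
qed

text \<open>This is the quotient of the tame functions 1 and \<open>exp (h z)\<close>.\<close>

lemma tame_exp_uminus:
  assumes "tame (\<lambda>z. exp (h z))" "h holomorphic_on UNIV"
  shows "tame (\<lambda>z. exp (- h z))"
  by (rule tame_exp_of_quotient[OF tame_const[of 1] assms(1), where w = 0])
    (use assms in \<open>auto intro!: holomorphic_intros simp flip: exp_add\<close>)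

text \<open>The modulus of \<open>exp (h z)\<close> depends only on \<open>Re (h z)\<close>, which
  scales with \<open>t\<close>. Real scaling is what makes the exponents with tame exponential a
  real vector space.\<close>

lemma tame_exp_scaleR:
  assumes "tame (\<lambda>z. exp (h z))" "h holomorphic_on UNIV"
  shows "tame (\<lambda>z. exp (of_real t * h z))"
proof -
  have *: "tame (\<lambda>z. exp (of_real t * h z))" if t: "t \<ge> 0" for t
  proof -
    obtain A where A: "A \<ge> 0"
      "\<And>k r R z. k \<ge> nat \<lceil>A\<rceil> \<Longrightarrow> 1 \<le> r \<Longrightarrow> r < R \<Longrightarrow> norm z \<le> r \<Longrightarrow> norm (exp (h z)) \<le> exp (A * (R / (R - r)) ^ k * L R)"
      using tameE[OF assms(1)] by blast
    show ?thesis
    proof (rule tameI[of _ "t * A" "nat \<lceil>A\<rceil>"])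
      show "norm (exp (of_real t * h z)) \<le> exp (t * A * (R / (R - r)) ^ nat \<lceil>A\<rceil> * L R)"
        if "1 \<le> r" "r < R" "norm z \<le> r" for r R z
        using A(2)[OF order_refl that] t by (simp add: mult.assoc mult_left_mono)
    qed (intro holomorphic_intros assms)
  qed
  show ?thesis
  proof (cases "t \<ge> 0")
    case False
    then show ?thesis
      using tame_exp_uminus[OF *[of "- t"]] by (simp add: holomorphic_intros assms)
  qed (rule *)
qed

text \<open>Borel's theorem: dividing the relation by one term and differentiating gives a shorter relation,
  and multiplying by the square of the coefficient of that term makes its coefficients tame again.\<close>

theorem borel_exponentials:
  assumes "finite J" and "\<And>j. j \<in> J \<Longrightarrow> tame (A j)"
    and h: "\<And>j. j \<in> J \<Longrightarrow> h j holomorphic_on UNIV" "\<And>j. j \<in> J \<Longrightarrow> tame (deriv (h j))"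
    and not_tame: "\<And>i j. i \<in> J \<Longrightarrow> j \<in> J \<Longrightarrow> i \<noteq> j \<Longrightarrow> \<not> tame (\<lambda>z. exp (h j z - h i z))"
    and "\<And>z. (\<Sum>j\<in>J. A j z * exp (h j z)) = 0"
  shows "\<forall>j\<in>J. \<forall>z. A j z = 0"
  using assms
proof (induction "card J" arbitrary: J A rule: less_induct)
  case less
  note fin = less.prems(1) and A = less.prems(2) and h = less.prems(3,4) and nt = less.prems(5) and eq = less.prems(6)
  show ?case
  proof (rule ccontr)
    assume "\<not> ?thesis"
    then obtain i w where i: "i \<in> J" "A i w \<noteq> 0"
      by auto
    have diff: "f field_differentiable at z" if "f holomorphic_on UNIV" for f :: "complex \<Rightarrow> complex" and z
      using that by (auto simp: holomorphic_on_def)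
    have DA: "(A j has_field_derivative deriv (A j) z) (at z)"
      and Dh: "(h j has_field_derivative deriv (h j) z) (at z)" if "j \<in> J" for j z
      using diff[OF tame_holomorphic[OF A[OF that]]] diff[OF h(1)[OF that]]
      by (simp_all add: DERIV_deriv_iff_field_differentiable)
    \<comment> \<open>Multiplied by \<open>exp (h j z - h i z)\<close>, this is
      \<open>A i z * A i z\<close> times the derivative of
      \<open>A j z / A i z * exp (h j z - h i z)\<close>. In particular \<open>B i\<close>
      vanishes.\<close>
    define B where "B j z = deriv (A j) z * A i z - A j z * deriv (A i) z
      + A j z * A i z * (deriv (h j) z - deriv (h i) z)" for j z
    have B0: "\<forall>j\<in>J - {i}. \<forall>z. B j z = 0"
    proof (rule less.hyps)
      show "card (J - {i}) < card J"
        using fin i by (intro psubset_card_mono) auto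
      show "tame (B j)" if "j \<in> J - {i}" for j
        unfolding B_def using that i by (intro tame_add tame_diff tame_mult tame_deriv A h(2)) auto
      show "(\<Sum>j\<in>J - {i}. B j z * exp (h j z)) = 0" for z
      proof -
        have "((\<lambda>z. \<Sum>j\<in>J. A j z * exp (h j z)) has_field_derivative
          (\<Sum>j\<in>J. A j z * (exp (h j z) * deriv (h j) z) + deriv (A j) z * exp (h j z))) (at z)"
          by (intro DERIV_sum DERIV_mult' DERIV_chain2[OF DERIV_exp] DA Dh)
        moreover have "((\<lambda>z. \<Sum>j\<in>J. A j z * exp (h j z)) has_field_derivative 0) (at z)"
          unfolding eq by simp
        ultimately have *: "(\<Sum>j\<in>J. A j z * (exp (h j z) * deriv (h j) z) + deriv (A j) z * exp (h j z)) = 0"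
          by (rule DERIV_unique)
        \<comment> \<open>The new relation combines the given one with its derivative; its term for
          \<open>i\<close> drops out because \<open>B i\<close> is 0.\<close>
        have "(\<Sum>j\<in>J. B j z * exp (h j z)) =
          A i z * (\<Sum>j\<in>J. A j z * (exp (h j z) * deriv (h j) z) + deriv (A j) z * exp (h j z))
          - (deriv (A i) z + A i z * deriv (h i) z) * (\<Sum>j\<in>J. A j z * exp (h j z))"
          unfolding sum_distrib_left sum_subtractf[symmetric]
          by (rule sum.cong) (simp_all add: B_def algebra_simps)
        also have "\<dots> = 0"
          by (simp add: * eq)
        also have "(\<Sum>j\<in>J. B j z * exp (h j z)) = B i z * exp (h i z) + (\<Sum>j\<in>J - {i}. B j z * exp (h j z))"
          by (rule sum.remove[OF fin i(1)])
        finally show ?thesis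
          by (simp add: B_def)
      qed
    qed (use fin h nt in auto)
    \<comment> \<open>As \<open>B j\<close> is 0, \<open>f / A i\<close> is a constant
      \<open>c\<close> near \<open>w\<close>. For nonzero \<open>c\<close> the exponential of
      \<open>h j - h i\<close> would be the quotient of \<open>c * A i\<close> by
      \<open>A j\<close>, hence tame.\<close>
    have zero: "A j z = 0" if j: "j \<in> J - {i}" for j z
    proof -
      define f where "f z = A j z * exp (h j z - h i z)" for z
      have f: "f holomorphic_on UNIV"
        unfolding f_def using i j by (intro holomorphic_intros h tame_holomorphic[OF A]) auto
      have "open {z. A i z \<noteq> 0}"
        using holomorphic_on_imp_continuous_on[OF tame_holomorphic[OF A[OF i(1)]]] by (intro open_Collect_neq) auto
      then obtain e where e: "e > 0" "ball w e \<subseteq> {z. A i z \<noteq> 0}"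
        using i(2) openE by blast
      have "((\<lambda>z. f z / A i z) has_field_derivative 0) (at z)" if "z \<in> ball w e" for z
      proof -
        have nz: "A i z \<noteq> 0"
          using e that by auto
        have "((\<lambda>z. f z / A i z) has_field_derivative
          ((A j z * (exp (h j z - h i z) * (deriv (h j) z - deriv (h i) z)) + deriv (A j) z * exp (h j z - h i z)) * A i z
            - f z * deriv (A i) z) / (A i z * A i z)) (at z)"
          unfolding f_def using i j nz
          by (intro DERIV_divide DERIV_mult' DERIV_chain2[OF DERIV_exp] DERIV_diff DA Dh) auto
        moreover have "(A j z * (exp (h j z - h i z) * (deriv (h j) z - deriv (h i) z)) + deriv (A j) z * exp (h j z - h i z)) * A i z
            - f z * deriv (A i) z = exp (h j z - h i z) * B j z"
          by (simp add: f_def B_def algebra_simps)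
        ultimately show ?thesis
          using B0 j by simp
      qed
      then have "(\<lambda>z. f z / A i z) constant_on ball w e"
        by (intro has_field_derivative_0_imp_constant_on) auto
      then obtain c where c: "\<And>z. z \<in> ball w e \<Longrightarrow> f z / A i z = c"
        by (auto simp: constant_on_def)
      have f_eq: "f z = c * A i z" for z
      proof (rule analytic_continuation_open[of "ball w e" UNIV f "\<lambda>z. c * A i z" z])
        show "f z = c * A i z" if "z \<in> ball w e" for z
          using c[OF that] e that by (auto simp: field_simps)
      qed (use e(1) f i(1) in \<open>auto intro!: holomorphic_intros tame_holomorphic[OF A]\<close>)
      have "c = 0"
      proof (rule ccontr)
        assume "c \<noteq> 0"
        have "A j w \<noteq> 0"
          using f_eq[of w] i(2) \<open>c \<noteq> 0\<close> by (auto simp: f_def)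
        then have "tame (\<lambda>z. exp (h j z - h i z))"
          using i j f_eq h by (intro tame_exp_of_quotient[OF tame_mult[OF tame_const[of c] A[of i]] A[of j]])
            (auto simp: f_def intro!: holomorphic_intros)
        then show False
          using nt i j by auto
      qed
      then show ?thesis
        using f_eq[of z] by (simp add: f_def)
    qed
    have "A i w * exp (h i w) + (\<Sum>j\<in>J - {i}. A j w * exp (h j w)) = 0"
      using eq[of w] sum.remove[OF fin i(1), of "\<lambda>j. A j w * exp (h j w)"] by simp
    then show False
      using zero i(2) by simp
  qed
qed

end

section \<open>Exponents of logarithmic growth\<close>

text \<open>If \<open>\<tau>\<close> were large at \<open>r\<close>, the hypothesis along \<open>\<rho>\<^sub>n = (2 - 2\<^sup>-\<^sup>n) r\<close> would make it
  unbounded below \<open>2 r\<close>.\<close>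

lemma logarithmic_growth:
  fixes \<tau> :: "real \<Rightarrow> real" and D :: nat
  assumes mono: "\<And>r s. 1 \<le> r \<Longrightarrow> r \<le> s \<Longrightarrow> \<tau> r \<le> \<tau> s"
    and D: "D \<ge> 1"
    and nonneg: "\<And>r. 1 \<le> r \<Longrightarrow> 0 \<le> \<tau> r"
    and le: "\<And>r R. 1 \<le> r \<Longrightarrow> r < R \<Longrightarrow> \<tau> r \<le> D * (R / (R - r)) ^ D * ln (3 + \<tau> R + R)"
  obtains C where "\<And>r. 1 \<le> r \<Longrightarrow> \<tau> r \<le> C + C * ln (6 + 4 * r)"
proof -
  \<comment> \<open>The 4 comes from the bound \<open>4 * 2 ^ n\<close> for
    \<open>R / (R - r)\<close> at consecutive radii below.\<close>
  define c where "c = real D * 4 ^ D"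
  have c: "c \<ge> 1"
    using D mult_mono[of 1 "real D" 1 "4 ^ D"] by (simp add: c_def)
  have "((\<lambda>x::real. x ^ Suc D / exp x) \<longlongrightarrow> 0) at_top"
    by (rule tendsto_power_div_exp_0)
  then have "eventually (\<lambda>x::real. x ^ Suc D / exp x < 1 / (2 * (c * 2 ^ Suc D))) at_top"
    using c by (intro order_tendstoD) auto
  then obtain s0 where s0: "\<And>s. s \<ge> s0 \<Longrightarrow> s ^ Suc D / exp s < 1 / (2 * (c * 2 ^ Suc D))"
    by (auto simp: eventually_at_top_linorder)
  have exp_ge: "2 * (c * 2 ^ Suc D * s ^ Suc D) \<le> exp s" if "s \<ge> s0" for s
    using s0[OF that] c by (simp add: field_simps)
  \<comment> \<open>For \<open>s\<close> at least \<open>p r\<close>, the exponential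
    \<open>exp s\<close> dominates both the power of \<open>s\<close> in \<open>exp_ge\<close> and
    the radius term \<open>6 + 4 * r\<close>.\<close>
  define p where "p r = max 1 (max s0 (ln (6 + 4 * r)))" for r
  have main: "\<tau> r \<le> c * p r" if r: "1 \<le> r" for r
  proof (rule ccontr)
    assume neg: "\<not> \<tau> r \<le> c * p r"
    have p: "p r \<ge> 1" "p r \<ge> s0" "exp (p r) \<ge> 6 + 4 * r"
    proof -
      have "6 + 4 * r = exp (ln (6 + 4 * r))"
        using r by simp
      also have "\<dots> \<le> exp (p r)"
        by (simp add: p_def)
      finally show "exp (p r) \<ge> 6 + 4 * r" .
    qed (auto simp: p_def)
    define \<rho> where "\<rho> n = r * (2 - (1 / 2) ^ n)" for n :: nat
    have half: "0 < (1 / 2 :: real) ^ n" "(1 / 2 :: real) ^ n \<le> 1" for n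
      by (auto intro: power_le_one)
    have \<rho>: "r \<le> \<rho> n" "\<rho> n \<le> 2 * r" for n
      using r half[of n] mult_left_mono[of 1 "2 - (1 / 2) ^ n" r] by (auto simp: \<rho>_def algebra_simps)
    have \<rho>_diff: "\<rho> (Suc n) - \<rho> n = r * (1 / 2) ^ Suc n" for n
      by (simp add: \<rho>_def algebra_simps)
    \<comment> \<open>Dividing the hypothesis by the loss \<open>c * 2 ^ (D * n)\<close> leaves the
      lower bound \<open>s = p r * 2 ^ n\<close> for the logarithm. Half of \<open>exp s\<close>
      covers \<open>3 + 2 * r\<close>; the other half bounds \<tau> from below at the next
      radius.\<close>
    have step: "c * p r * 2 ^ (Suc D * n) \<le> \<tau> (\<rho> n)" for n
    proof (induction n)
      case 0
      then show ?case
        using neg by (simp add: \<rho>_def)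
    next
      case (Suc n)
      define s where "s = p r * 2 ^ n"
      have s: "p r \<le> s"
        using p by (simp add: s_def)
      have lt: "\<rho> n < \<rho> (Suc n)"
        using \<rho>_diff[of n] r half(1)[of "Suc n"] by (smt (verit) mult_pos_pos)
      have ratio: "\<rho> (Suc n) / (\<rho> (Suc n) - \<rho> n) \<le> 4 * 2 ^ n"
      proof -
        have "\<rho> (Suc n) / (\<rho> (Suc n) - \<rho> n) \<le> 2 * r / (r * (1 / 2) ^ Suc n)"
          unfolding \<rho>_diff using \<rho>(2)[of "Suc n"] r by (intro divide_right_mono) auto
        also have "\<dots> = 4 * 2 ^ n"
          using r by (simp add: field_simps power_divide)
        finally show ?thesis .
      qed
      have "c * 2 ^ (D * n) * s = c * p r * 2 ^ (Suc D * n)"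
        by (simp add: s_def power_add mult_ac)
      also have "\<dots> \<le> D * (\<rho> (Suc n) / (\<rho> (Suc n) - \<rho> n)) ^ D * ln (3 + \<tau> (\<rho> (Suc n)) + \<rho> (Suc n))"
        using Suc.IH le[OF _ lt] \<rho>(1)[of n] r by linarith
      also have "\<dots> \<le> real D * (4 * 2 ^ n) ^ D * ln (3 + \<tau> (\<rho> (Suc n)) + \<rho> (Suc n))"
      proof (rule mult_right_mono[OF mult_left_mono[OF power_mono[OF ratio]]])
        show "0 \<le> \<rho> (Suc n) / (\<rho> (Suc n) - \<rho> n)" "0 \<le> ln (3 + \<tau> (\<rho> (Suc n)) + \<rho> (Suc n))"
          using lt \<rho>(1)[of "Suc n"] r nonneg[of "\<rho> (Suc n)"] by auto
      qed simp
      also have "\<dots> = c * 2 ^ (D * n) * ln (3 + \<tau> (\<rho> (Suc n)) + \<rho> (Suc n))"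
        by (simp add: c_def power_mult_distrib power_mult mult.commute[of D n])
      finally have "s \<le> ln (3 + \<tau> (\<rho> (Suc n)) + \<rho> (Suc n))"
        using c by simp
      then have "exp s \<le> 3 + \<tau> (\<rho> (Suc n)) + \<rho> (Suc n)"
        using \<rho>(1)[of "Suc n"] r nonneg[of "\<rho> (Suc n)"] by (simp add: ln_ge_iff)
      then have "exp s \<le> 3 + \<tau> (\<rho> (Suc n)) + 2 * r"
        using \<rho>(2)[of "Suc n"] by linarith
      moreover have "6 + 4 * r \<le> exp s"
        using p(3) s by (meson exp_le_cancel_iff order_trans)
      moreover have "2 * (c * 2 ^ Suc D * s ^ Suc D) \<le> exp s"
        using p s by (intro exp_ge) linarith
      moreover have "c * p r * 2 ^ (Suc D * Suc n) \<le> c * 2 ^ Suc D * s ^ Suc D"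
      proof -
        have "p r ^ 1 \<le> p r ^ Suc D"
          using p by (intro power_increasing) auto
        then have "c * (2 ^ Suc D * (2 ^ n) ^ Suc D) * p r ^ 1 \<le> c * (2 ^ Suc D * (2 ^ n) ^ Suc D) * p r ^ Suc D"
          using c by (intro mult_left_mono) auto
        also have "\<dots> = c * 2 ^ Suc D * s ^ Suc D"
          by (simp only: s_def power_mult_distrib mult_ac)
        also have "(2::real) ^ Suc D * (2 ^ n) ^ Suc D = 2 ^ (Suc D * Suc n)"
          by (simp only: power_mult[symmetric] power_add[symmetric]) (simp add: algebra_simps)
        finally show ?thesis
          by (simp only: power_one_right mult_ac)
      qed
      ultimately show ?case
        by linarith
    qed
    obtain n where n: "\<tau> (2 * r) < 2 ^ n"
      using real_arch_pow[of 2] by auto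
    have "(2::real) ^ n \<le> 2 ^ (Suc D * n)"
      by (intro power_increasing) auto
    also have "\<dots> \<le> c * p r * 2 ^ (Suc D * n)"
      using mult_mono[of 1 c 1 "p r"] c p by simp
    also have "\<dots> \<le> \<tau> (2 * r)"
      using step[of n] mono[of "\<rho> n" "2 * r"] \<rho>[of n] r by linarith
    finally show False
      using n by simp
  qed
  show ?thesis
  proof (rule that[of "c * (1 + \<bar>s0\<bar>)"])
    fix r :: real assume r: "1 \<le> r"
    have "ln (6 + 4 * r) \<ge> 0"
      using r by simp
    then have "p r \<le> (1 + \<bar>s0\<bar>) * (1 + ln (6 + 4 * r))"
      by (auto simp: p_def algebra_simps max_def mult_nonneg_nonneg add_nonneg_nonneg)
    then have "c * p r \<le> c * ((1 + \<bar>s0\<bar>) * (1 + ln (6 + 4 * r)))"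
      using c by (intro mult_left_mono) auto
    then show "\<tau> r \<le> c * (1 + \<bar>s0\<bar>) + c * (1 + \<bar>s0\<bar>) * ln (6 + 4 * r)"
      using main[OF r] by (simp add: algebra_simps)
  qed
qed

text \<open>Cauchy's estimate on circles of radius \<open>r\<close> bounds the derivative by a
  quantity of order \<open>ln r / r\<close>.\<close>

lemma entire_logarithmic_growth_constant:
  fixes g :: "complex \<Rightarrow> complex"
  assumes g: "g holomorphic_on UNIV"
    and le: "\<And>r z. 1 \<le> r \<Longrightarrow> norm z \<le> r \<Longrightarrow> norm (g z) \<le> C + C * ln (6 + 4 * r)"
  shows "g z = g 0"
proof -
  have "deriv g z = 0" for z
  proof -
    have "norm (deriv g z) \<le> (C + C * ln (6 + 4 * (norm z + r))) / r" if "r \<ge> 1" for r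
    proof -
      have "norm ((deriv ^^ 1) g z) \<le> fact 1 * (C + C * ln (6 + 4 * (norm z + r))) / r ^ 1"
      proof (rule Cauchy_inequality)
        show "norm (g w) \<le> C + C * ln (6 + 4 * (norm z + r))" if "norm (z - w) = r" for w
          using that \<open>r \<ge> 1\<close> norm_triangle_ineq4[of z "z - w"] norm_ge_zero[of z]
          by (intro le) (simp_all del: norm_ge_zero)
      qed (use that g in \<open>auto intro: holomorphic_on_subset holomorphic_on_imp_continuous_on continuous_on_subset\<close>)
      then show ?thesis
        by simp
    qed
    then have "eventually (\<lambda>r. norm (deriv g z) \<le> (C + C * ln (6 + 4 * (norm z + r))) / r) at_top"
      unfolding eventually_at_top_linorder by blast
    moreover have "((\<lambda>r. (C + C * ln (6 + 4 * (norm z + r))) / r) \<longlongrightarrow> 0) at_top"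
      by real_asymp
    ultimately have "norm (deriv g z) \<le> 0"
      by (intro tendsto_lowerbound[of _ 0 at_top]) auto
    then show ?thesis
      by simp
  qed
  then have "(g has_field_derivative 0) (at z)" for z
    using holomorphic_derivI[OF g open_UNIV UNIV_I, of z] by simp
  then have "g constant_on UNIV"
    by (intro has_field_derivative_0_imp_constant_on) auto
  then show ?thesis
    by (auto simp: constant_on_def)
qed

text \<open>For the last conclusion, tame exponentials bound all \<open>Re (g i z)\<close>, and
  \<open>norm_le_of_Re_pos\<close> turns this into a bound for \<open>norm (g i z)\<close>. The
  maximum \<tau> then satisfies the hypothesis of \<open>logarithmic_growth\<close>, which forces
  the \<open>g i\<close> to be constant.\<close>

lemma exists_growth_scale:
  fixes g :: "'i::finite \<Rightarrow> complex \<Rightarrow> complex"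
  assumes g: "\<And>i. g i holomorphic_on UNIV"
  obtains L where "growth_scale L" "\<And>i. growth_scale.tame L (g i)"
    "\<And>i z. (\<And>j. growth_scale.tame L (\<lambda>z. exp (g j z))) \<Longrightarrow> g i z = g i 0"
proof -
  define S where "S z = (\<Sum>i\<in>UNIV. norm (g i z))" for z
  define \<tau> where "\<tau> r = (SUP z\<in>cball 0 r. S z)" for r
  \<comment> \<open>The 3 ensures that \<open>L R\<close> is at least 1, as \<open>exp 1\<close> is
    at most 3. The logarithm is just enough for each \<open>g i\<close> to be tame, and makes
    tameness of \<open>exp (g i z)\<close> a strong condition.\<close>
  define L where "L R = ln (3 + \<tau> R + R)" for R
  have "continuous_on UNIV S"
    unfolding S_def by (intro continuous_on_sum continuous_on_norm holomorphic_on_imp_continuous_on g)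
  then have "compact (S ` cball 0 r)" for r
    by (meson compact_cball compact_continuous_image continuous_on_subset subset_UNIV)
  then have bdd: "bdd_above (S ` cball 0 r)" for r
    by (intro bounded_imp_bdd_above compact_imp_bounded)
  have S_le: "S z \<le> \<tau> r" if "norm z \<le> r" for z r
    unfolding \<tau>_def using that by (intro cSUP_upper bdd) auto
  have S_nonneg: "S z \<ge> 0" for z
    by (auto simp: S_def sum_nonneg)
  have nonneg: "\<tau> r \<ge> 0" if "r \<ge> 0" for r
    using S_le[of 0 r] S_nonneg[of 0] that by simp
  have g_le: "norm (g i z) \<le> S z" for i z
    unfolding S_def by (rule member_le_sum) auto
  have mono: "\<tau> r \<le> \<tau> s" if "1 \<le> r" "r \<le> s" for r s
    unfolding \<tau>_def using that by (intro cSUP_subset_mono bdd) auto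
  interpret growth_scale L
  proof
    show "1 \<le> L R" if "1 \<le> R" for R
      using exp_le nonneg[of R] that by (simp add: L_def ln_ge_iff)
  qed
  have "tame (g i)" for i
  proof (rule tame_of_norm_le[OF g])
    show "norm (g i z) \<le> exp (L R)" if "norm z \<le> R" for R z
    proof -
      have "R \<ge> 0"
        using that norm_ge_zero[of z] by linarith
      then show ?thesis
        using g_le[of i z] S_le[OF that] nonneg[of R] by (simp add: L_def)
    qed
  qed
  moreover have "g i z = g i 0" if tame: "\<And>i. tame (\<lambda>z. exp (g i z))" for i z
  proof -
    have "\<forall>i. \<exists>A. A \<ge> 0 \<and> (\<forall>k r R z. k \<ge> nat \<lceil>A\<rceil> \<longrightarrow> 1 \<le> r \<longrightarrow> r < R \<longrightarrow> norm z \<le> r \<longrightarrow>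
        norm (exp (g i z)) \<le> exp (A * (R / (R - r)) ^ k * L R))"
      using tameE[OF tame] by metis
    then obtain A where A: "\<And>i. A i \<ge> 0"
      "\<And>i k r R z. k \<ge> nat \<lceil>A i\<rceil> \<Longrightarrow> 1 \<le> r \<Longrightarrow> r < R \<Longrightarrow> norm z \<le> r \<Longrightarrow> Re (g i z) \<le> A i * (R / (R - r)) ^ k * L R"
      unfolding norm_exp_eq_Re exp_le_cancel_iff by metis
    define k where "k = (\<Sum>i\<in>UNIV. nat \<lceil>A i\<rceil>)"
    define a where "a = (\<Sum>i\<in>UNIV. A i)"
    have k: "nat \<lceil>A i\<rceil> \<le> k" for i
      unfolding k_def by (rule member_le_sum) auto
    have a: "A i \<le> a" for i
      unfolding a_def using A(1) by (intro member_le_sum) auto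
    have a0: "a \<ge> 0"
      by (auto simp: a_def sum_nonneg A(1))
    define b where "b = a * 2 ^ k + 1 + S 0"
    have b: "b \<ge> 0"
      using a0 S_nonneg by (simp add: b_def)
    \<comment> \<open>\<open>logarithmic_growth\<close> takes one natural number both as constant
      and as exponent.\<close>
    define D where "D = max (Suc k) (nat \<lceil>CARD('i) * (5 * b)\<rceil>)"
    have D: "D \<ge> Suc k" "CARD('i) * (5 * b) \<le> D"
      unfolding D_def by linarith+
    have le: "\<tau> r \<le> D * (R / (R - r)) ^ D * ln (3 + \<tau> R + R)" if *: "1 \<le> r" "r < R" for r R
    proof -
      define x where "x = R / (R - r)"
      have x: "x \<ge> 1"
        using * by (simp add: x_def divide_simps)
      define d where "d = (R - r) / 2"
      have d: "d > 0" "r + d < R" "1 \<le> r + d"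
        using * by (auto simp: d_def field_simps)
      have Rd: "R / (R - (r + d)) = 2 * x"
        using * by (simp add: d_def x_def field_simps)
      define M where "M = a * (2 * x) ^ k * L R"
      have L1: "L R \<ge> 1"
        using * by (intro L_ge_1) auto
      have M: "M \<ge> 0"
        using a0 x L1 by (simp add: M_def)
      have Re_le: "Re (g i w) \<le> M" if "norm w \<le> r + d" for i w
      proof -
        have "Re (g i w) \<le> A i * (2 * x) ^ k * L R"
          using A(2)[OF k, of "r + d" R w i] that d by (simp add: Rd)
        also have "\<dots> \<le> M"
          unfolding M_def using a[of i] x L1 by (intro mult_right_mono) auto
        finally show ?thesis .
      qed
      have g_bound: "norm (g i z) \<le> 5 * b * x ^ Suc k * L R" if z: "norm z \<le> r" for i z
      proof -
        define p where "p w = of_real (M + 1) - g i w" for w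
        have "norm (p z) \<le> norm (p 0) * ((r + d + norm z) / (r + d - norm z))"
        proof (rule norm_le_of_Re_pos)
          show "p holomorphic_on ball 0 (r + d)"
            unfolding p_def by (intro holomorphic_intros holomorphic_on_subset[OF g]) auto
          show "Re (p w) > 0" if "norm w < r + d" for w
            using Re_le[of w i] that by (simp add: p_def)
        qed (use z d in auto)
        also have "\<dots> \<le> (M + 1 + S 0) * (4 * x)"
        proof (rule mult_mono)
          show "norm (p 0) \<le> M + 1 + S 0"
            using norm_triangle_ineq4[of "of_real (M + 1)" "g i 0"] M g_le[of i 0] by (simp add: p_def del: of_real_add)
          have "(r + d + norm z) / (r + d - norm z) \<le> (2 * R) / d"
            using z d by (intro frac_le) auto
          also have "\<dots> = 4 * x"
            by (simp add: d_def x_def)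
          finally show "(r + d + norm z) / (r + d - norm z) \<le> 4 * x" .
        qed (use M S_nonneg z d in auto)
        finally have "norm (p z) \<le> (M + 1 + S 0) * (4 * x)" .
        moreover have "norm (g i z) \<le> M + 1 + norm (p z)"
          using norm_triangle_ineq4[of "of_real (M + 1)" "p z"] M by (simp add: p_def del: of_real_add)
        moreover have "M + 1 \<le> (M + 1 + S 0) * x"
          using M x S_nonneg[of 0] mult_mono[of "M + 1" "M + 1 + S 0" 1 x] by simp
        \<comment> \<open>The 5 consists of 4 from the estimate of \<open>p z\<close> and 1 from
          \<open>M + 1\<close>.\<close>
        ultimately have "norm (g i z) \<le> 5 * x * (M + 1 + S 0)"
          by (simp add: algebra_simps)
        also have "\<dots> \<le> 5 * x * (b * x ^ k * L R)"
        proof (rule mult_left_mono)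
          have "1 * 1 \<le> x ^ k * L R"
            using x L1 by (intro mult_mono one_le_power) auto
          then have "(1 + S 0) * 1 \<le> (1 + S 0) * (x ^ k * L R)"
            using S_nonneg[of 0] by (intro mult_left_mono) auto
          moreover have "M = a * 2 ^ k * (x ^ k * L R)"
            by (simp add: M_def power_mult_distrib)
          ultimately show "M + 1 + S 0 \<le> b * x ^ k * L R"
            by (simp add: b_def algebra_simps)
        qed (use x in auto)
        finally show ?thesis
          by (simp add: mult_ac)
      qed
      have "\<tau> r \<le> CARD('i) * (5 * b * x ^ Suc k * L R)"
        unfolding \<tau>_def
      proof (rule cSUP_least)
        show "S z \<le> CARD('i) * (5 * b * x ^ Suc k * L R)" if "z \<in> cball 0 r" for z
          unfolding S_def using that by (intro sum_bounded_above g_bound) auto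
      qed (use * in auto)
      also have "\<dots> = CARD('i) * (5 * b) * x ^ Suc k * L R"
        by simp
      also have "\<dots> \<le> D * x ^ D * L R"
        using D x L1 b by (intro mult_mono power_increasing order_refl) auto
      finally show ?thesis
        by (simp add: x_def L_def)
    qed
    obtain C where C: "\<And>r. 1 \<le> r \<Longrightarrow> \<tau> r \<le> C + C * ln (6 + 4 * r)"
      using logarithmic_growth[of \<tau> D, OF mono _ _ le] nonneg D(1) by fastforce
    show ?thesis
    proof (rule entire_logarithmic_growth_constant[OF g])
      show "norm (g i z) \<le> C + C * ln (6 + 4 * r)" if "1 \<le> r" "norm z \<le> r" for r z
        using g_le[of i z] S_le[OF that(2)] C[OF that(1)] by linarith
    qed
  qed
  ultimately show ?thesis
    using that growth_scale_axioms by metis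
qed

section \<open>Classes of exponentials and barycentric coordinates\<close>

text \<open>The component of \<open>x\<close> orthogonal to \<open>K\<close> is a canonical
  representative of its class modulo \<open>K\<close>, depending linearly on
  \<open>x\<close>.\<close>

lemma subspace_projection:
  fixes K :: "'a::euclidean_space set"
  assumes K: "subspace K"
  obtains p :: "'a \<Rightarrow> 'a" where "linear p" "\<And>x. x - p x \<in> K" "\<And>x. p x = 0 \<longleftrightarrow> x \<in> K"
proof -
  have "\<exists>z. x - z \<in> K \<and> (\<forall>k\<in>K. z \<bullet> k = 0)" for x
  proof -
    obtain y z where "y \<in> span K" "\<And>w. w \<in> span K \<Longrightarrow> orthogonal z w" "x = y + z"
      using orthogonal_subspace_decomp_exists[of K x] by blast
    then show ?thesis
      using span_eq_iff[THEN iffD2, OF K] by (intro exI[of _ z]) (auto simp: orthogonal_def)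
  qed
  then obtain p where p: "\<And>x. x - p x \<in> K" "\<And>x k. k \<in> K \<Longrightarrow> p x \<bullet> k = 0"
    by metis
  have unique: "p x = z" if "x - z \<in> K" "\<And>k. k \<in> K \<Longrightarrow> z \<bullet> k = 0" for x z
  proof -
    have "(x - z) - (x - p x) \<in> K"
      by (rule subspace_diff[OF K that(1) p(1)])
    then have "p x - z \<in> K"
      by simp
    then have "(p x - z) \<bullet> (p x - z) = 0"
      using that p by (simp add: inner_diff_left)
    then show ?thesis
      by simp
  qed
  have "linear p"
  proof
    show "p (x + y) = p x + p y" for x y
      using subspace_add[OF K p(1)[of x] p(1)[of y]] by (intro unique) (auto simp: p inner_add_left algebra_simps)
    show "p (r *\<^sub>R x) = r *\<^sub>R p x" for r x
      using subspace_scale[OF K p(1)[of x], of r] by (intro unique) (auto simp: p algebra_simps)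
  qed
  moreover have "p x = 0 \<longleftrightarrow> x \<in> K" for x
    using p(1)[of x] unique[of x 0] by auto
  ultimately show ?thesis
    using that p(1) by blast
qed

text \<open>The exponent vectors with tame exponential form a real subspace. Terms whose vectors
  agree modulo this subspace merge into one term with tame coefficient, and Borel's theorem makes
  each class vanish separately.\<close>

lemma (in growth_scale) borel_classes:
  fixes g :: "'m::finite \<Rightarrow> complex \<Rightarrow> complex"
  assumes g: "\<And>i. tame (g i)"
  obtains p :: "real ^ 'm \<Rightarrow> real ^ 'm" where "linear p"
    "\<And>t. p t = 0 \<longleftrightarrow> tame (\<lambda>z. exp (\<Sum>i\<in>UNIV. of_real (t $ i) * g i z))"
    "\<And>(E :: 'a set) \<kappa> \<epsilon> s z. finite E \<Longrightarrow>
      (\<And>z. (\<Sum>a\<in>E. \<kappa> a * exp (\<Sum>i\<in>UNIV. of_real (\<epsilon> a $ i) * g i z)) = 0) \<Longrightarrow>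
      (\<Sum>a | a \<in> E \<and> p (\<epsilon> a) = s. \<kappa> a * exp (\<Sum>i\<in>UNIV. of_real (\<epsilon> a $ i) * g i z)) = 0"
proof -
  define h where "h t z = (\<Sum>i\<in>UNIV. of_real (t $ i) * g i z)" for t :: "real ^ 'm" and z
  have tame_h: "tame (h t)" for t
    unfolding h_def by (intro tame_sum tame_mult tame_const g)
  have h_add: "h (s + t) z = h s z + h t z" and h_diff: "h (s - t) z = h s z - h t z"
    and h_scale: "h (r *\<^sub>R t) z = of_real r * h t z" for r s t z
    by (simp_all add: h_def algebra_simps sum.distrib sum_subtractf sum_distrib_left)
  define K where "K = {t. tame (\<lambda>z. exp (h t z))}"
  have "subspace K"
  proof (rule subspaceI)
    show "0 \<in> K"
      by (simp add: K_def h_def tame_const)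
    show "s + t \<in> K" if "s \<in> K" "t \<in> K" for s t
      using that by (simp add: K_def h_add exp_add tame_mult)
    show "r *\<^sub>R t \<in> K" if "t \<in> K" for r t
      using that tame_exp_scaleR[OF _ tame_holomorphic[OF tame_h]] by (simp add: K_def h_scale)
  qed
  then obtain p :: "real ^ 'm \<Rightarrow> real ^ 'm" where p: "linear p" "\<And>x. x - p x \<in> K" "\<And>x. p x = 0 \<longleftrightarrow> x \<in> K"
    using subspace_projection by blast
  have idem: "p (p x) = p x" for x
    using p(2,3)[of "x"] p(3)[of "x - p x"] linear_diff[OF p(1), of x "p x"] by simp
  show ?thesis
  proof (rule that[OF p(1)])
    show "p t = 0 \<longleftrightarrow> tame (\<lambda>z. exp (\<Sum>i\<in>UNIV. of_real (t $ i) * g i z))" for t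
      using p(3)[of t] by (simp add: K_def h_def)
  next
    fix E :: "'a set" and \<kappa> \<epsilon> s z
    assume E: "finite E" and eq: "\<And>z. (\<Sum>a\<in>E. \<kappa> a * exp (\<Sum>i\<in>UNIV. of_real (\<epsilon> a $ i) * g i z)) = 0"
    define A where "A s z = (\<Sum>a | a \<in> E \<and> p (\<epsilon> a) = s. \<kappa> a * exp (h (\<epsilon> a - s) z))" for s z
    have A: "A s z * exp (h s z) = (\<Sum>a | a \<in> E \<and> p (\<epsilon> a) = s. \<kappa> a * exp (h (\<epsilon> a) z))" for s z
      by (simp add: A_def sum_distrib_right h_diff mult.assoc flip: exp_add)
    have "\<forall>s\<in>(\<lambda>a. p (\<epsilon> a)) ` E. \<forall>z. A s z = 0"
    proof (rule borel_exponentials)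
      show "tame (A s)" for s
      proof -
        have "tame (\<lambda>z. exp (h (\<epsilon> a - s) z))" if "p (\<epsilon> a) = s" for a
          using p(2)[of "\<epsilon> a"] that by (simp add: K_def)
        then show ?thesis
          unfolding A_def by (intro tame_sum tame_mult tame_const) auto
      qed
      show "h s holomorphic_on UNIV" "tame (deriv (h s))" for s
        by (intro tame_holomorphic tame_deriv tame_h)+
      \<comment> \<open>Values of \<open>p\<close> are fixed by \<open>p\<close>, so two of them in
        the same class coincide.\<close>
      show "\<not> tame (\<lambda>z. exp (h t z - h s z))"
        if st: "s \<in> (\<lambda>a. p (\<epsilon> a)) ` E" "t \<in> (\<lambda>a. p (\<epsilon> a)) ` E" "s \<noteq> t" for s t
      proof
        assume "tame (\<lambda>z. exp (h t z - h s z))"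
        then have "p (t - s) = 0"
          by (simp add: p(3) K_def h_diff)
        then have "p t = p s"
          by (simp add: linear_diff[OF p(1)])
        moreover have "p t = t" "p s = s"
          using st idem by auto
        ultimately show False
          using st by simp
      qed
      show "(\<Sum>s\<in>(\<lambda>a. p (\<epsilon> a)) ` E. A s z * exp (h s z)) = 0" for z
        using eq[of z] sum.image_gen[OF E, of "\<lambda>a. \<kappa> a * exp (h (\<epsilon> a) z)" "\<lambda>a. p (\<epsilon> a)"]
        unfolding A unfolding h_def by simp
    qed (use E in auto)
    then have "A s z = 0" if "s \<in> (\<lambda>a. p (\<epsilon> a)) ` E"
      using that by blast
    moreover have "A s z = 0" if "s \<notin> (\<lambda>a. p (\<epsilon> a)) ` E"
      unfolding A_def using that by (intro sum.neutral) auto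
    ultimately have "A s z = 0"
      by blast
    then show "(\<Sum>a | a \<in> E \<and> p (\<epsilon> a) = s. \<kappa> a * exp (\<Sum>i\<in>UNIV. of_real (\<epsilon> a $ i) * g i z)) = 0"
      using A[of s z] by (simp add: h_def)
  qed
qed

text \<open>The map \<Phi> is bijective: a nonzero vector orthogonal to its range would be an affine
  equation satisfied by all \<open>c i\<close>, and the dimensions agree. Its inverse at
  \<open>(0, x)\<close> writes the vector \<open>x\<close> as a combination of the points with total
  weight 0.\<close>

lemma simplex_coordinates:
  fixes c :: "'n::finite \<Rightarrow> 'a::euclidean_space"
  assumes card: "CARD('n) = DIM('a) + 1"
    and simplex: "\<And>a b. a \<noteq> 0 \<Longrightarrow> \<exists>i. a \<bullet> c i \<noteq> b"
  obtains l :: "'a \<Rightarrow> real ^ 'n" where "linear l" "\<And>x. (\<Sum>i\<in>UNIV. l x $ i) = 0"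
    "\<And>x. (\<Sum>i\<in>UNIV. l x $ i *\<^sub>R c i) = x"
    "\<And>t. (\<Sum>i\<in>UNIV. t $ i) = 0 \<Longrightarrow> l (\<Sum>i\<in>UNIV. t $ i *\<^sub>R c i) = t"
proof -
  define \<Phi> :: "real ^ 'n \<Rightarrow> real \<times> 'a" where "\<Phi> t = (\<Sum>i\<in>UNIV. t $ i, \<Sum>i\<in>UNIV. t $ i *\<^sub>R c i)" for t
  have lin: "linear \<Phi>"
    by (rule linearI) (simp_all add: \<Phi>_def sum.distrib scaleR_add_left sum_distrib_left scaleR_sum_right)
  have "surj \<Phi>"
  proof (rule ccontr)
    assume neg: "\<not> surj \<Phi>"
    have sub: "subspace (range \<Phi>)"
      using lin by (simp add: linear_subspace_image)
    from neg have "dim (range \<Phi>) \<noteq> DIM(real \<times> 'a)"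
      unfolding dim_eq_full span_eq_iff[THEN iffD2, OF sub] .
    then have "dim (range \<Phi>) < DIM(real \<times> 'a)"
      using dim_subset_UNIV[of "range \<Phi>"] by linarith
    then obtain y where y: "y \<noteq> 0" "\<And>x. x \<in> span (range \<Phi>) \<Longrightarrow> orthogonal y x"
      using orthogonal_to_subspace_exists by blast
    have "\<Phi> (axis i 1) = (1, c i)" for i
      by (simp add: \<Phi>_def axis_def if_distrib[of "\<lambda>x. x *\<^sub>R _"] cong: if_cong)
    then have *: "fst y + snd y \<bullet> c i = 0" for i
      using y(2)[OF span_base[OF rangeI], of "axis i 1"] by (cases y) (simp add: orthogonal_def)
    have "snd y \<noteq> 0"
      using *[of undefined] y(1) by (auto simp: prod_eq_iff)
    then obtain i where "snd y \<bullet> c i \<noteq> - fst y"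
      using simplex by blast
    then show False
      using *[of i] by simp
  qed
  moreover from this have "inj \<Phi>"
    using lin card by (intro linear_surjective_imp_injective) auto
  ultimately obtain \<Psi> where \<Psi>: "linear \<Psi>" "\<And>t. \<Psi> (\<Phi> t) = t" "\<And>y. \<Phi> (\<Psi> y) = y"
    using linear_injective_left_inverse[OF lin] by (metis comp_apply id_apply surj_def)
  have \<Phi>l: "\<Phi> (\<Psi> (0, x)) = (0, x)" for x
    by (rule \<Psi>)
  show ?thesis
  proof (rule that[of "\<lambda>x. \<Psi> (0, x)"])
    show "linear (\<lambda>x. \<Psi> (0, x))"
      using linear_add[OF \<Psi>(1), of "(0, _)" "(0, _)"] linear_scale[OF \<Psi>(1), of _ "(0, _)"]
      by (intro linearI) simp_all
    show "(\<Sum>i\<in>UNIV. \<Psi> (0, x) $ i) = 0" "(\<Sum>i\<in>UNIV. \<Psi> (0, x) $ i *\<^sub>R c i) = x" for x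
      using \<Phi>l[of x] by (simp_all add: \<Phi>_def)
    show "\<Psi> (0, \<Sum>i\<in>UNIV. t $ i *\<^sub>R c i) = t" if "(\<Sum>i\<in>UNIV. t $ i) = 0" for t :: "real ^ 'n"
      using \<Psi>(2)[of t] that by (simp add: \<Phi>_def)
  qed
qed

section \<open>Stem functions\<close>

lemma quat_imaginary_unit:
  fixes I :: quat
  assumes "norm I = 1" "qRe I = 0"
  shows "I * I = -1"
proof -
  have "(qI I)\<^sup>2 + (qJ I)\<^sup>2 + (qK I)\<^sup>2 = 1"
    using assms by (simp add: norm_quat_def)
  then show ?thesis
    using assms(2) by (simp add: quat_eq_iff power2_eq_square)
qed

lemma quat_slice:
  fixes q :: quat
  obtains x y I where "I * I = -1" "q = x *\<^sub>R 1 + y *\<^sub>R I"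
proof -
  define v where "v = q - qRe q *\<^sub>R 1"
  have v: "qRe v = 0" "q = qRe q *\<^sub>R 1 + v"
    by (simp_all add: v_def)
  show ?thesis
  proof (cases "v = 0")
    case True
    then show ?thesis
      using that[of "Quat 0 1 0 0" "qRe q" 0] v(2) quat_unit_products(1) by simp
  next
    case False
    have "(v /\<^sub>R norm v) * (v /\<^sub>R norm v) = -1"
      using False v(1) by (intro quat_imaginary_unit) auto
    then show ?thesis
      using that[of "v /\<^sub>R norm v" "qRe q" "norm v"] False v(2) by simp
  qed
qed

lemma quat_power_slice:
  fixes I :: quat
  assumes "I * I = -1"
  shows "(x *\<^sub>R 1 + y *\<^sub>R I) ^ k = Re (Complex x y ^ k) *\<^sub>R 1 + Im (Complex x y ^ k) *\<^sub>R I"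
  by (induction k) (simp_all add: assms algebra_simps)

text \<open>\<open>F e\<close> is the \<open>e\<close>-coordinate of the stem function of \<open>f\<close>, with values in the complexified quaternions.\<close>

lemma stem_function:
  assumes "entire_slice_regular f"
  obtains F :: "quat \<Rightarrow> complex \<Rightarrow> complex" where
    "\<And>e. F e holomorphic_on UNIV" "\<And>e x. F e (of_real x) \<in> \<real>"
    "\<And>I x y. I * I = -1 \<Longrightarrow> f (x *\<^sub>R 1 + y *\<^sub>R I) =
      (\<Sum>e\<in>Basis. Re (F e (Complex x y)) *\<^sub>R e) + I * (\<Sum>e\<in>Basis. Im (F e (Complex x y)) *\<^sub>R e)"
proof -
  obtain a where a: "\<And>q. (\<lambda>k. q ^ k * a k) sums f q"
    using assms by (auto simp: entire_slice_regular_def)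
  \<comment> \<open>At real arguments the powers are real scalars, so each coordinate of the series
    is a real power series converging everywhere.\<close>
  have summable_real: "summable (\<lambda>k. (a k \<bullet> e) * R ^ k)" for e R
  proof -
    have "(\<lambda>k. (of_real R ^ k * a k) \<bullet> e) sums (f (of_real R) \<bullet> e)"
      by (rule bounded_linear.sums[OF bounded_linear_inner_left a])
    moreover have "(of_real R ^ k * a k) \<bullet> e = (a k \<bullet> e) * R ^ k" for k
      by (simp add: of_real_def scaleR_power)
    ultimately show ?thesis
      by (simp add: sums_iff)
  qed
  have summable: "summable (\<lambda>k. complex_of_real (a k \<bullet> e) * z ^ k)" for e z
  proof (rule powser_inside)
    show "summable (\<lambda>k. complex_of_real (a k \<bullet> e) * of_real (norm z + 1) ^ k)"
      using summable_of_real[OF summable_real[of e "norm z + 1"], where 'a = complex] by simp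
    show "norm z < norm (complex_of_real (norm z + 1))"
      unfolding norm_of_real by simp
  qed
  define F where "F e z = (\<Sum>k. complex_of_real (a k \<bullet> e) * z ^ k)" for e z
  have F: "(\<lambda>k. complex_of_real (a k \<bullet> e) * z ^ k) sums F e z" for e z
    unfolding F_def by (rule summable_sums[OF summable])
  show ?thesis
  proof (rule that)
    show "F e holomorphic_on UNIV" for e
      unfolding F_def[abs_def] holomorphic_on_open[OF open_UNIV]
      using termdiffs_strong_converges_everywhere[OF summable] by blast
    show "F e (of_real x) \<in> \<real>" for e x
    proof -
      have "(\<lambda>k. complex_of_real ((a k \<bullet> e) * x ^ k)) sums of_real (\<Sum>k. (a k \<bullet> e) * x ^ k)"
        by (intro sums_of_real summable_sums summable_real)
      then have "F e (of_real x) = of_real (\<Sum>k. (a k \<bullet> e) * x ^ k)"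
        using F[of e "of_real x"] by (simp add: sums_unique2)
      then show ?thesis
        by simp
    qed
    fix I :: quat and x y :: real assume I: "I * I = -1"
    let ?z = "Complex x y"
    have repr: "t *\<^sub>R a k = (\<Sum>e\<in>Basis. (a k \<bullet> e * t) *\<^sub>R e)" for t k
      by (subst (1) euclidean_representation[of "a k", symmetric])
        (simp add: scaleR_sum_right mult.commute)
    have "(\<lambda>k. \<Sum>e\<in>Basis. Re (complex_of_real (a k \<bullet> e) * ?z ^ k) *\<^sub>R e) sums (\<Sum>e\<in>Basis. Re (F e ?z) *\<^sub>R e)"
      by (intro sums_sum bounded_linear.sums[OF bounded_linear_scaleR_left] bounded_linear.sums[OF bounded_linear_Re] F)
    then have P: "(\<lambda>k. Re (?z ^ k) *\<^sub>R a k) sums (\<Sum>e\<in>Basis. Re (F e ?z) *\<^sub>R e)"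
      by (simp add: repr)
    have "(\<lambda>k. \<Sum>e\<in>Basis. Im (complex_of_real (a k \<bullet> e) * ?z ^ k) *\<^sub>R e) sums (\<Sum>e\<in>Basis. Im (F e ?z) *\<^sub>R e)"
      by (intro sums_sum bounded_linear.sums[OF bounded_linear_scaleR_left] bounded_linear.sums[OF bounded_linear_Im] F)
    then have Q: "(\<lambda>k. Im (?z ^ k) *\<^sub>R a k) sums (\<Sum>e\<in>Basis. Im (F e ?z) *\<^sub>R e)"
      by (simp add: repr)
    have "(\<lambda>k. Re (?z ^ k) *\<^sub>R a k + I * (Im (?z ^ k) *\<^sub>R a k)) sums
      ((\<Sum>e\<in>Basis. Re (F e ?z) *\<^sub>R e) + I * (\<Sum>e\<in>Basis. Im (F e ?z) *\<^sub>R e))"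
      by (intro sums_add P bounded_linear.sums[OF bounded_linear_mult_right Q])
    moreover have "(x *\<^sub>R 1 + y *\<^sub>R I) ^ k * a k = Re (?z ^ k) *\<^sub>R a k + I * (Im (?z ^ k) *\<^sub>R a k)" for k
      by (simp add: quat_power_slice[OF I] distrib_right)
    ultimately show "f (x *\<^sub>R 1 + y *\<^sub>R I) =
      (\<Sum>e\<in>Basis. Re (F e ?z) *\<^sub>R e) + I * (\<Sum>e\<in>Basis. Im (F e ?z) *\<^sub>R e)"
      using a[of "x *\<^sub>R 1 + y *\<^sub>R I"] by (simp add: sums_unique2)
  qed
qed

text \<open>Hence a slice regular function omits \<open>c\<close> only if its stem function omits this quadric.\<close>

lemma quat_quadric:
  fixes c :: quat
  assumes "(\<Sum>e\<in>Basis. (w e - complex_of_real (c \<bullet> e))\<^sup>2) = 0"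
  obtains I where "I * I = -1" "(\<Sum>e\<in>Basis. Re (w e) *\<^sub>R e) + I * (\<Sum>e\<in>Basis. Im (w e) *\<^sub>R e) = c"
proof -
  define P where "P = (\<Sum>e\<in>Basis. Re (w e) *\<^sub>R e) - c"
  define Q :: quat where "Q = (\<Sum>e\<in>Basis. Im (w e) *\<^sub>R e)"
  have P: "P \<bullet> e = Re (w e) - c \<bullet> e" and Q: "Q \<bullet> e = Im (w e)" if "e \<in> Basis" for e
    using that by (simp_all add: P_def Q_def inner_diff_left inner_sum_left_Basis)
  \<comment> \<open>The real and imaginary parts of the quadric equation say that \<open>P\<close>
    and \<open>Q\<close> have equal norm and are orthogonal.\<close>
  have "P \<bullet> P - Q \<bullet> Q = (\<Sum>e\<in>Basis. Re ((w e - complex_of_real (c \<bullet> e))\<^sup>2))"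
    unfolding euclidean_inner[of P P] euclidean_inner[of Q Q] sum_subtractf[symmetric]
    by (rule sum.cong) (simp_all add: P Q power2_eq_square)
  also have "\<dots> = 0"
    using assms by (simp flip: Re_sum)
  finally have norm: "norm P = norm Q"
    by (simp add: norm_eq_sqrt_inner)
  have "2 * (P \<bullet> Q) = (\<Sum>e\<in>Basis. Im ((w e - complex_of_real (c \<bullet> e))\<^sup>2))"
    unfolding euclidean_inner[of P Q] sum_distrib_left
    by (rule sum.cong) (simp_all add: P Q power2_eq_square)
  also have "\<dots> = 0"
    using assms by (simp flip: Im_sum)
  finally have orth: "P \<bullet> Q = 0"
    by simp
  have "\<exists>I. I * I = -1 \<and> P + I * Q = 0"
  proof (cases "Q = 0")
    case True
    then show ?thesis
      using norm quat_unit_products(1) by auto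
  next
    case False
    \<comment> \<open>This solves \<open>P + I * Q = 0\<close>. Equal norms give it norm 1, and its
      real part is a multiple of \<open>P \<bullet> Q\<close>, hence 0.\<close>
    define I where "I = - (P * inverse Q)"
    have "norm I = 1"
      using False norm by (simp add: I_def norm_mult norm_inverse)
    moreover have "qRe I = - ((P \<bullet> Q) / ((qRe Q)\<^sup>2 + (qI Q)\<^sup>2 + (qJ Q)\<^sup>2 + (qK Q)\<^sup>2))"
      by (simp add: I_def inner_quat_def add_divide_distrib)
    ultimately have "I * I = -1"
      using orth by (intro quat_imaginary_unit) auto
    moreover have "P + I * Q = 0"
      using False by (simp add: I_def mult.assoc)
    ultimately show ?thesis
      by blast
  qed
  then show ?thesis
    using that by (auto simp: P_def Q_def algebra_simps)
qed

section \<open>Omitted values\<close>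

text \<open>Strict convexity of balls, by the parallelogram law; it identifies the products that lie
  in the top class.\<close>

lemma eq_midpoint_of_norm_le:
  fixes a b w :: "'a::real_inner"
  assumes "norm a \<le> norm w" "norm b \<le> norm w" "a + b = 2 *\<^sub>R w"
  shows "a = w \<and> b = w"
proof -
  have "(norm (a - b))\<^sup>2 = 2 * (norm a)\<^sup>2 + 2 * (norm b)\<^sup>2 - (norm (a + b))\<^sup>2"
    by (simp add: power2_norm_eq_inner algebra_simps inner_commute)
  also have "\<dots> = 2 * (norm a)\<^sup>2 + 2 * (norm b)\<^sup>2 - 4 * (norm w)\<^sup>2"
    unfolding assms(3) by (simp add: power_mult_distrib)
  also have "\<dots> \<le> 0"
    using power_mono[OF assms(1) norm_ge_zero, of 2] power_mono[OF assms(2) norm_ge_zero, of 2] by linarith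
  finally have "a = b"
    by simp
  then show ?thesis
    using assms(3) by (simp flip: scaleR_2)
qed

lemma sum_UNIV_option:
  fixes h :: "'n::finite option \<Rightarrow> 'a::comm_monoid_add"
  shows "(\<Sum>j\<in>UNIV. h j) = h None + (\<Sum>i\<in>UNIV. h (Some i))"
  by (simp add: UNIV_option_conv sum.reindex)

theorem omits_simplex_imp_constant:
  fixes c :: "'n::finite \<Rightarrow> quat"
  assumes card: "CARD('n) = 5"
    and simplex: "\<And>a b. a \<noteq> 0 \<Longrightarrow> \<exists>i. a \<bullet> c i \<noteq> b"
    and f: "entire_slice_regular f"
    and omits: "\<And>q i. f q \<noteq> c i"
  shows "f constant_on UNIV"
proof -

  \<comment> \<open>The zero-free entire functions attached to the omitted points\<close>
  obtain F :: "quat \<Rightarrow> complex \<Rightarrow> complex" where F: "\<And>e. F e holomorphic_on UNIV"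
    and F_real: "\<And>e x. F e (of_real x) \<in> \<real>"
    and f_eq: "\<And>I x y. I * I = -1 \<Longrightarrow> f (x *\<^sub>R 1 + y *\<^sub>R I) =
      (\<Sum>e\<in>Basis. Re (F e (Complex x y)) *\<^sub>R e) + I * (\<Sum>e\<in>Basis. Im (F e (Complex x y)) *\<^sub>R e)"
    using stem_function[OF f] by blast
  define u where "u i z = (\<Sum>e\<in>Basis. (F e z - complex_of_real (c i \<bullet> e))\<^sup>2)" for i z
  have u: "u i holomorphic_on UNIV" for i
    unfolding u_def by (intro holomorphic_intros F)
  have u_nz: "u i z \<noteq> 0" for i z
  proof
    assume "u i z = 0"
    then obtain I where "I * I = -1" "(\<Sum>e\<in>Basis. Re (F e z) *\<^sub>R e) + I * (\<Sum>e\<in>Basis. Im (F e z) *\<^sub>R e) = c i"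
      unfolding u_def by (rule quat_quadric)
    then show False
      using f_eq[of I "Re z" "Im z"] omits by auto
  qed
  have u_real: "u i (of_real x) \<in> \<real>" for i x
    unfolding u_def by (intro sum_in_Reals Reals_power Reals_diff F_real) auto
  have "\<exists>g. g holomorphic_on UNIV \<and> (\<forall>z. exp (g z) = u i z)" for i
    by (rule holomorphic_logarithm_exists[OF convex_UNIV open_UNIV u[of i]]) (use u_nz in auto)
  then obtain g where g: "\<And>i. g i holomorphic_on UNIV" "\<And>i z. exp (g i z) = u i z"
    by metis
  \<comment> \<open>The index \<open>None\<close> stands for the constant function 1.\<close>
  define G where "G = (\<lambda>j. case j of None \<Rightarrow> \<lambda>_. 0 | Some i \<Rightarrow> g i)"
  define U where "U = (\<lambda>j. case j of None \<Rightarrow> \<lambda>_. 1 | Some i \<Rightarrow> u i)"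
  have G: "G j holomorphic_on UNIV" for j
    by (auto simp: G_def g split: option.split)
  have exp_G: "exp (G j z) = U j z" for j z
    by (auto simp: G_def U_def g split: option.split)
  obtain L where L: "growth_scale L" and tame_G: "\<And>j. growth_scale.tame L (G j)"
    and const_G: "\<And>i z. (\<And>j. growth_scale.tame L (\<lambda>z. exp (G j z))) \<Longrightarrow> G i z = G i 0"
    using exists_growth_scale[of G, OF G] by blast
  let ?tame = "growth_scale.tame L"

  \<comment> \<open>The stem function as an affine combination of these functions\<close>
  obtain l :: "quat \<Rightarrow> real ^ 'n" where l: "linear l" "\<And>x. (\<Sum>i\<in>UNIV. l x $ i) = 0"
    "\<And>x. (\<Sum>i\<in>UNIV. l x $ i *\<^sub>R c i) = x"
    "\<And>t. (\<Sum>i\<in>UNIV. t $ i) = 0 \<Longrightarrow> l (\<Sum>i\<in>UNIV. t $ i *\<^sub>R c i) = t"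
    using simplex_coordinates[of c] card simplex by auto
  \<comment> \<open>The weights \<open>l e $ i\<close> sum to 0, which cancels the common square
    term of the \<open>u i\<close>, and they combine the \<open>c i\<close> to \<open>e\<close>,
    which turns the linear part into \<open>- 2 * F e z\<close>. Half of the remaining constant is
    \<open>b e\<close>.\<close>
  define b where "b e = (\<Sum>i\<in>UNIV. l e $ i * (c i \<bullet> c i)) / 2" for e
  have F_eq: "F e z = of_real (b e) - (\<Sum>i\<in>UNIV. of_real (l e $ i) * u i z) / 2" if e: "e \<in> Basis" for e z
  proof -
    have ci: "(\<Sum>i\<in>UNIV. of_real (l e $ i) * complex_of_real (c i \<bullet> d)) = of_real (e \<bullet> d)" for d
    proof -
      have "(\<Sum>i\<in>UNIV. l e $ i *\<^sub>R c i) \<bullet> d = e \<bullet> d"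
        by (simp add: l(3))
      then have "(\<Sum>i\<in>UNIV. l e $ i * (c i \<bullet> d)) = e \<bullet> d"
        by (simp add: inner_sum_left)
      then show ?thesis
        by (metis (mono_tags, lifting) of_real_mult of_real_sum sum.cong)
    qed
    define N where "N = (\<Sum>d\<in>Basis. (F d z)\<^sup>2)"
    have uN: "u i z = N - 2 * (\<Sum>d\<in>Basis. F d z * of_real (c i \<bullet> d)) + of_real (c i \<bullet> c i)" for i
      unfolding euclidean_inner[of "c i" "c i"] u_def N_def
      by (simp add: power2_diff sum.distrib sum_subtractf sum_distrib_left power2_eq_square algebra_simps)
    have "(\<Sum>i\<in>UNIV. of_real (l e $ i) * u i z) =
      (\<Sum>i\<in>UNIV. of_real (l e $ i) * N - 2 * (\<Sum>d\<in>Basis. F d z * (of_real (l e $ i) * of_real (c i \<bullet> d)))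
        + of_real (l e $ i) * of_real (c i \<bullet> c i))"
      unfolding uN by (intro sum.cong refl) (simp add: ring_distribs sum_distrib_left mult_ac)
    also have "\<dots> =
      (\<Sum>i\<in>UNIV. of_real (l e $ i)) * N
      - 2 * (\<Sum>i\<in>UNIV. \<Sum>d\<in>Basis. F d z * (of_real (l e $ i) * of_real (c i \<bullet> d)))
      + (\<Sum>i\<in>UNIV. of_real (l e $ i) * of_real (c i \<bullet> c i))"
      by (simp only: sum.distrib sum_subtractf sum_distrib_left sum_distrib_right)
    also have "(\<Sum>i\<in>UNIV. complex_of_real (l e $ i)) = 0"
      using l(2)[of e] by (simp flip: of_real_sum)
    also have "(\<Sum>i\<in>UNIV. \<Sum>d\<in>Basis. F d z * (of_real (l e $ i) * of_real (c i \<bullet> d))) =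
      (\<Sum>d\<in>Basis. F d z * of_real (e \<bullet> d))"
      by (subst sum.swap) (simp add: ci flip: sum_distrib_left)
    also have "\<dots> = (\<Sum>d\<in>Basis. if d = e then F e z else 0)"
      using e by (intro sum.cong) (auto simp: inner_Basis)
    also have "\<dots> = F e z"
      using e by simp
    finally show ?thesis
      by (simp add: b_def diff_divide_distrib)
  qed

  \<comment> \<open>Classes of the exponentials modulo tame ones\<close>
  obtain p :: "real ^ 'n option \<Rightarrow> real ^ 'n option" where p: "linear p"
    "\<And>t. p t = 0 \<longleftrightarrow> ?tame (\<lambda>z. exp (\<Sum>j\<in>UNIV. of_real (t $ j) * G j z))"
    "\<And>(E :: ('n option \<times> 'n option) set) \<kappa> \<epsilon> s z. finite E \<Longrightarrow>
      (\<And>z. (\<Sum>a\<in>E. \<kappa> a * exp (\<Sum>j\<in>UNIV. of_real (\<epsilon> a $ j) * G j z)) = 0) \<Longrightarrow>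
      (\<Sum>a | a \<in> E \<and> p (\<epsilon> a) = s. \<kappa> a * exp (\<Sum>j\<in>UNIV. of_real (\<epsilon> a $ j) * G j z)) = 0"
    using growth_scale.borel_classes[OF L, of G, OF tame_G] by blast
  define v where "v j = p (axis j 1)" for j
  have axis_G: "(\<Sum>m\<in>UNIV. of_real ((axis j 1 :: real ^ 'n option) $ m) * G m z) = G j z" for j z
    by (simp add: axis_def if_distrib[of "\<lambda>x. of_real x * _"] cong: if_cong)
  have v_0: "v j = 0 \<longleftrightarrow> ?tame (\<lambda>z. exp (G j z))" for j
    by (simp add: v_def p(2) axis_G)
  have v_None: "v None = 0"
    by (simp add: v_0 G_def growth_scale.tame_const[OF L])
  obtain j0 where j0: "\<And>j. norm (v j) \<le> norm (v j0)"
  proof -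
    have "Max (range (\<lambda>j. norm (v j))) \<in> range (\<lambda>j. norm (v j))"
      by (intro Max_in) auto
    then obtain j0 where "Max (range (\<lambda>j. norm (v j))) = norm (v j0)"
      by (rule imageE)
    then show ?thesis
      using that[of j0] Max_ge[of "range (\<lambda>j. norm (v j))"] by simp
  qed

  \<comment> \<open>Constancy of the stem function\<close>
  have F_const: "F e z = F e 0" if e: "e \<in> Basis" for e z
  proof (cases "v j0 = 0")
    case True
    then have "?tame (\<lambda>z. exp (G j z))" for j
      using j0[of j] by (simp flip: v_0)
    then have "G (Some i) z = G (Some i) 0" for i
      by (rule const_G)
    then have "u i z = u i 0" for i
      by (simp add: G_def flip: g(2))
    then show ?thesis
      by (simp add: F_eq[OF e])
  next
    case False
    define T where "T = {j. v j = v j0}"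
    have None_T: "None \<notin> T"
      using False by (auto simp: T_def v_None)
    define i0 :: 'n where "i0 = undefined"
    \<comment> \<open>Coefficients of \<open>F e z - c i0 \<bullet> e\<close> in the
      \<open>U j\<close>; the constant term is carried by \<open>U None\<close>, which is 1.\<close>
    define \<mu> where "\<mu> e j = complex_of_real (case j of None \<Rightarrow> b e - c i0 \<bullet> e | Some i \<Rightarrow> - l e $ i / 2)" for e j
    have \<mu>: "F e z - of_real (c i0 \<bullet> e) = (\<Sum>j\<in>UNIV. \<mu> e j * U j z)" if "e \<in> Basis" for e z
      by (simp add: sum_UNIV_option \<mu>_def U_def F_eq[OF that] sum_divide_distrib sum_negf)
    \<comment> \<open>Inserting \<mu> into the definition of \<open>u i0\<close> gives the quadratic
      relation. Writing \<open>u i0\<close> as \<open>U None * U (Some i0)\<close> makes it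
      homogeneous, and this extra monomial stays outside \<open>T \<times> T\<close> because
      \<open>None\<close> is not in \<open>T\<close>.\<close>
    define \<kappa> where "\<kappa> a = (\<Sum>e\<in>Basis. \<mu> e (fst a) * \<mu> e (snd a)) - (if a = (None, Some i0) then 1 else 0)"
      for a :: "'n option \<times> 'n option"
    define \<epsilon> :: "'n option \<times> 'n option \<Rightarrow> real ^ 'n option" where "\<epsilon> a = axis (fst a) 1 + axis (snd a) 1" for a
    have \<epsilon>: "exp (\<Sum>m\<in>UNIV. of_real (\<epsilon> a $ m) * G m z) = U (fst a) z * U (snd a) z" for a z
      by (simp add: \<epsilon>_def ring_distribs sum.distrib axis_G exp_add exp_G)
    have square: "(\<Sum>e\<in>Basis. (\<Sum>j\<in>T. \<mu> e j * U j z)\<^sup>2) =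
      (\<Sum>a\<in>T \<times> T. (\<Sum>e\<in>Basis. \<mu> e (fst a) * \<mu> e (snd a)) * (U (fst a) z * U (snd a) z))" for T z
    proof -
      have "(\<Sum>j\<in>T. \<mu> e j * U j z)\<^sup>2 = (\<Sum>a\<in>T \<times> T. \<mu> e (fst a) * \<mu> e (snd a) * (U (fst a) z * U (snd a) z))" for e
        by (simp add: power2_eq_square sum_product sum.cartesian_product split_def mult_ac)
      then show ?thesis
        unfolding sum_distrib_right by (simp only: sum.swap[of _ "T \<times> T"])
    qed
    have relation: "(\<Sum>a\<in>UNIV. \<kappa> a * exp (\<Sum>m\<in>UNIV. of_real (\<epsilon> a $ m) * G m z)) = 0" for z
    proof -
      have "(\<Sum>a\<in>UNIV. \<kappa> a * (U (fst a) z * U (snd a) z)) =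
        (\<Sum>e\<in>Basis. (\<Sum>j\<in>UNIV. \<mu> e j * U j z)\<^sup>2) - (\<Sum>a\<in>UNIV. (if a = (None, Some i0) then 1 else 0) * (U (fst a) z * U (snd a) z))"
        unfolding square \<kappa>_def left_diff_distrib sum_subtractf by simp
      also have "(\<Sum>e\<in>Basis. (\<Sum>j\<in>UNIV. \<mu> e j * U j z)\<^sup>2) = u i0 z"
        unfolding u_def by (rule sum.cong) (simp_all add: \<mu>)
      also have "(\<Sum>a\<in>UNIV. (if a = (None, Some i0) then 1 else 0) * (U (fst a) z * U (snd a) z)) = u i0 z"
        by (simp add: if_distrib[of "\<lambda>x. x * _"] U_def cong: if_cong)
      finally show ?thesis
        by (simp add: \<epsilon>)
    qed
    \<comment> \<open>\<open>v j0\<close> has maximal norm, so by strict convexity only products of units in \<open>T\<close> have class \<open>2 v j0\<close>.\<close>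
    have "{a. a \<in> UNIV \<and> p (\<epsilon> a) = 2 *\<^sub>R v j0} = T \<times> T"
    proof -
      have "p (\<epsilon> a) = v (fst a) + v (snd a)" for a
        by (simp add: \<epsilon>_def v_def linear_add[OF p(1)])
      then show ?thesis
        using eq_midpoint_of_norm_le[OF j0 j0] by (auto simp: T_def scaleR_2)
    qed
    then have "(\<Sum>a\<in>T \<times> T. \<kappa> a * (U (fst a) z * U (snd a) z)) = 0" for z
      using p(3)[OF finite relation, where s = "2 *\<^sub>R v j0" and z = z] by (simp add: \<epsilon>)
    moreover have "(\<Sum>a\<in>T \<times> T. \<kappa> a * (U (fst a) z * U (snd a) z)) = (\<Sum>e\<in>Basis. (\<Sum>j\<in>T. \<mu> e j * U j z)\<^sup>2)" for z
      unfolding square by (rule sum.cong) (use None_T in \<open>auto simp: \<kappa>_def\<close>)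
    ultimately have top: "(\<Sum>e\<in>Basis. (\<Sum>j\<in>T. \<mu> e j * U j z)\<^sup>2) = 0" for z
      by simp
    \<comment> \<open>On the real axis the squares in \<open>top\<close> are nonnegative, so each of them vanishes.\<close>
    have F_real_const: "F e (of_real x) = of_real (b e)" for x
    proof -
      \<comment> \<open>The default 0 extends the sum over \<open>T\<close> to all indices. It also
        detects membership in \<open>T\<close>, since the values of \<open>u i\<close> on the real
        axis are real and nonzero.\<close>
      define \<alpha> where "\<alpha> i = (if Some i \<in> T then Re (u i (of_real x)) else 0)" for i
      have u_Re: "u i (of_real x) = of_real (Re (u i (of_real x)))" for i
        using u_real[of i x] by (simp add: of_real_Re)
      have sum_T: "(\<Sum>j\<in>T. \<mu> e j * U j (of_real x)) = of_real (- (\<Sum>i\<in>UNIV. l e $ i * \<alpha> i) / 2)" for e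
      proof -
        have "(\<Sum>j\<in>T. \<mu> e j * U j (of_real x)) = (\<Sum>j\<in>UNIV. if j \<in> T then \<mu> e j * U j (of_real x) else 0)"
          by (simp add: sum.If_cases)
        also have "\<dots> = (\<Sum>i\<in>UNIV. complex_of_real (- l e $ i / 2 * \<alpha> i))"
          unfolding sum_UNIV_option using None_T
          by (auto simp: \<mu>_def U_def \<alpha>_def u_Re[symmetric] intro!: sum.cong)
        also have "\<dots> = of_real (- (\<Sum>i\<in>UNIV. l e $ i * \<alpha> i) / 2)"
          by (simp add: sum_divide_distrib sum_negf)
        finally show ?thesis .
      qed
      have "complex_of_real (\<Sum>e\<in>Basis. (- (\<Sum>i\<in>UNIV. l e $ i * \<alpha> i) / 2)\<^sup>2) = 0"
        using top[of "of_real x"] unfolding sum_T by simp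
      then have "(\<Sum>e\<in>Basis. (- (\<Sum>i\<in>UNIV. l e $ i * \<alpha> i) / 2)\<^sup>2) = 0"
        by (simp only: of_real_eq_0_iff)
      then have zero_Basis: "(\<Sum>i\<in>UNIV. l e $ i * \<alpha> i) = 0" if "e \<in> Basis" for e
        using that by (subst (asm) sum_nonneg_eq_0_iff) auto
      \<comment> \<open>So \<alpha> is orthogonal to the range of \<open>l\<close>, which consists
        of all vectors with coordinate sum 0; hence its entries agree.\<close>
      have zero: "l x \<bullet> (\<chi> i. \<alpha> i) = 0" for x
      proof -
        have "l x = (\<Sum>e\<in>Basis. (x \<bullet> e) *\<^sub>R l e)"
          by (subst euclidean_representation[symmetric]) (simp add: linear_sum[OF l(1)] linear_scale[OF l(1)])
        moreover have "l e \<bullet> (\<chi> i. \<alpha> i) = 0" if "e \<in> Basis" for e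
          using zero_Basis[OF that] by (simp add: inner_vec_def)
        ultimately show ?thesis
          by (simp add: inner_sum_left)
      qed
      have \<alpha>_eq: "\<alpha> i = \<alpha> k" for i k
      proof -
        define t :: "real ^ 'n" where "t = axis i 1 - axis k 1"
        have "(\<Sum>i\<in>UNIV. t $ i) = 0"
          by (simp add: t_def axis_def sum_subtractf)
        then have "t \<bullet> (\<chi> i. \<alpha> i) = 0"
          using zero l(4) by metis
        then show ?thesis
          by (simp add: t_def inner_diff_left inner_axis')
      qed
      have "j0 \<in> T"
        by (simp add: T_def)
      then obtain k where k: "j0 = Some k" "Some k \<in> T"
        using None_T by (cases j0) auto
      then have "\<alpha> k \<noteq> 0"
        using u_nz[of k "of_real x"] u_Re[of k] by (auto simp: \<alpha>_def)
      \<comment> \<open>The common entry is nonzero, so no entry is the default: every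
        \<open>Some i\<close> lies in \<open>T\<close>, all \<open>u i\<close> agree at the real
        point, and the weighted sum in \<open>F_eq\<close> vanishes there.\<close>
      then have "\<alpha> i = Re (u i (of_real x))" for i
        using \<alpha>_eq[of i k] by (auto simp: \<alpha>_def split: if_splits)
      then have "u i (of_real x) = of_real (\<alpha> k)" for i
        using \<alpha>_eq[of i k] u_Re[of i] by simp
      then have "(\<Sum>i\<in>UNIV. of_real (l e $ i) * u i (of_real x)) = of_real ((\<Sum>i\<in>UNIV. l e $ i) * \<alpha> k)"
        by (simp add: sum_distrib_right)
      then show ?thesis
        by (simp add: F_eq[OF e] l(2))
    qed
    have "F e w - of_real (b e) = 0" for w
    proof (rule analytic_continuation[of "\<lambda>w. F e w - of_real (b e)" UNIV "\<real>" 0])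
      show "(0::complex) islimpt \<real>"
        unfolding islimpt_approachable
      proof (intro allI impI)
        fix r :: real assume "r > 0"
        then show "\<exists>w\<in>\<real>. w \<noteq> 0 \<and> dist w (0::complex) < r"
          by (intro bexI[of _ "of_real (r / 2)"]) auto
      qed
      show "F e w - of_real (b e) = 0" if "w \<in> \<real>" for w
        using that F_real_const by (auto elim: Reals_cases)
    qed (auto intro!: holomorphic_intros F)
    then show ?thesis
      by (metis eq_iff_diff_eq_0)
  qed

  \<comment> \<open>Return from the stem function to the quaternions\<close>
  have "f q = (\<Sum>e\<in>Basis. Re (F e 0) *\<^sub>R e)" for q
  proof -
    obtain I x y where q: "I * I = -1" "q = x *\<^sub>R 1 + y *\<^sub>R I"
      using quat_slice[of q] by blast
    have FC: "F e (Complex x y) = F e 0" if "e \<in> Basis" for e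
      by (rule F_const[OF that])
    have "Im (F e 0) = 0" for e
      using F_real[of e 0] by (simp add: complex_is_Real_iff)
    then show ?thesis
      unfolding q(2) f_eq[OF q(1)] by (simp add: FC)
  qed
  then show ?thesis
    by (auto simp: constant_on_def)
qed

theorem theorem3p5:
  fixes c1 c2 c3 c4 c5 :: quat and f :: "quat \<Rightarrow> quat"
  assumes "\<not> (\<exists>A :: quat set. affine A \<and> aff_dim A = 3 \<and> {c1, c2, c3, c4, c5} \<subseteq> A)"
    and "entire_slice_regular f"
    and "range f \<subseteq> UNIV - {c1, c2, c3, c4, c5}"
  shows "f constant_on UNIV"
proof -
  \<comment> \<open>Three options over \<open>bool\<close> give an index type with exactly five
    elements.\<close>
  define c :: "bool option option option \<Rightarrow> quat" where
    "c = case_option c1 (case_option c2 (case_option c3 (\<lambda>x. if x then c4 else c5)))"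
  have range_c: "range c = {c1, c2, c3, c4, c5}"
    by (simp add: c_def UNIV_option_conv UNIV_bool image_image insert_commute)
  show ?thesis
  proof (rule omits_simplex_imp_constant[of c])
    show "CARD(bool option option option) = 5"
      by simp
    \<comment> \<open>A hyperplane through all five points would be an excluded affine subspace of
      dimension 3.\<close>
    show "\<exists>i. a \<bullet> c i \<noteq> b" if "a \<noteq> 0" for a b
    proof (rule ccontr)
      assume "\<not> (\<exists>i. a \<bullet> c i \<noteq> b)"
      then have "range c \<subseteq> {x. a \<bullet> x = b}"
        by auto
      moreover have "affine {x. a \<bullet> x = b}" "aff_dim {x. a \<bullet> x = b} = 3"
        using that by (simp_all add: affine_hyperplane)
      ultimately show False
        using assms(1) unfolding range_c by blast
    qed
    show "f q \<noteq> c i" for q i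
      using assms(3) range_c by blast
  qed (rule assms(2))
qed

end
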